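(* Let $\mathscr H,\mathscr K$ be complex Hilbert spaces and let $A,B,X,Y\in\mathbb B(\mathscr H)$ be arbitrary operators. Let $\Phi:\mathbb B(\mathscr H)\to\mathbb B(\mathscr K)$ be a (not necessarily linear) map. (i) If $\Phi$ is weakly $2$-positive, then $$\Phi(|X^*A^*Y|)\le \Phi(V^*X^*|A|XV)\,\#\,\Phi(Y^*|A^*|Y),$$ where $X^*A^*Y=V|X^*A^*Y|$ is the polar decomposition of $X^*A^*Y$. (ii) If $\Phi$ is a $2$-positive $*$-map, then $$|\Phi(X^*A^*Y)|\le \big(U^*\Phi(X^*|A|X)U\big)\,\#\,\Phi(Y^*|A^*|Y),$$ where $\Phi(X^*A^*Y)=U|\Phi(X^*A^*Y)|$ is the polar decomposition of $\Phi(X^*A^*Y)$.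
   Context: $\mathbb B(\mathscr H)$ is the algebra of bounded linear operators on $\mathscr H$; $A\ge0$ means $\langle A\xi,\xi\rangle\ge0$ for all $\xi$, and $A\le B$ means $B-A\ge0$ for self-adjoint $A,B$. $|A|=(A^*A)^{1/2}$. The polar decomposition of $A$ is $A=U|A|$ with $U$ the unique partial isometry with $\ker U=\ker|A|$. Maps $\Phi:\mathbb B(\mathscr H)\to\mathbb B(\mathscr K)$ are not assumed linear. $\Phi$ is $2$-positive if $\Phi_2([A_{ij}]_{2\times2})=[\Phi(A_{ij})]_{2\times2}$, as a map $\mathbb B(\mathscr H\oplus\mathscr H)\to\mathbb B(\mathscr K\oplus\mathscr K)$, sends every positive block matrix to a positive block matrix. $\Phi$ is weakly $2$-positive if $\Phi_2$ sends every positive block matrix of the form $\begin{bmatrix}A&C\\ C&B\end{bmatrix}$ to a positive block matrix. $\Phi$ is a $*$-map if $\Phi(A^* )=\Phi(A)^*$ for all $A$. The geometric mean of positive operators $A,B$ on a Hilbert space is $$A\,\#\,B=\max\left\{X=X^*:\ \begin{bmatrix}A&X\\ X&B\end{bmatrix}\ge0\right\}$$ (the maximum with respect to $\le$, which exists). *)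

theory Defs
  imports "HOL-Analysis.Analysis"
begin

section \<open>Complex Hilbert spaces\<close>

text \<open>The inner product \<open>cinner\<close> is linear in its first argument. Norm and topology are those of the
  underlying real inner product space, whose inner product is the real part of \<open>cinner\<close>.\<close>

class complex_vector = real_vector +
  fixes scaleC :: "complex \<Rightarrow> 'a \<Rightarrow> 'a" (infixr "*\<^sub>C" 75)
  assumes scaleC_add_right: "c *\<^sub>C (x + y) = c *\<^sub>C x + c *\<^sub>C y"
    and scaleC_add_left: "(c + d) *\<^sub>C x = c *\<^sub>C x + d *\<^sub>C x"
    and scaleC_scaleC: "c *\<^sub>C d *\<^sub>C x = (c * d) *\<^sub>C x"
    and scaleR_scaleC: "r *\<^sub>R x = complex_of_real r *\<^sub>C x"

class complex_inner = complex_vector + real_inner +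
  fixes cinner :: "'a \<Rightarrow> 'a \<Rightarrow> complex"
  assumes cinner_commute: "cinner x y = cnj (cinner y x)"
    and cinner_add_left: "cinner (x + y) z = cinner x z + cinner y z"
    and cinner_scaleC_left: "cinner (c *\<^sub>C x) y = c * cinner x y"
    and inner_eq_Re_cinner: "inner x y = Re (cinner x y)"

class chilbert_space = complex_inner + complete_space

lemma scaleC_zero_right: "c *\<^sub>C (0::'a::complex_vector) = 0"
  using scaleC_add_right[of c "0::'a" 0] by simp

lemma scaleC_minus_right: "c *\<^sub>C (- x) = - (c *\<^sub>C (x::'a::complex_vector))"
  using scaleC_add_right[of c x "- x"] by (simp add: scaleC_zero_right eq_neg_iff_add_eq_0 add.commute)

lemma scaleC_diff_right: "c *\<^sub>C (x - y) = c *\<^sub>C x - c *\<^sub>C (y::'a::complex_vector)"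
  using scaleC_add_right[of c x "- y"] by (simp add: scaleC_minus_right)

instantiation prod :: (complex_vector, complex_vector) complex_vector
begin

definition scaleC_prod_def: "c *\<^sub>C p = (c *\<^sub>C fst p, c *\<^sub>C snd p)"

instance
  by standard
    (simp_all add: scaleC_prod_def scaleR_prod_def scaleC_add_right scaleC_add_left
      scaleC_scaleC scaleR_scaleC)

end

instantiation prod :: (complex_inner, complex_inner) complex_inner
begin

definition cinner_prod_def: "cinner p q = cinner (fst p) (fst q) + cinner (snd p) (snd q)"

instance
proof
  fix p q r :: "'a \<times> 'b" and c :: complex
  show "cinner p q = cnj (cinner q p)"
    by (simp add: cinner_prod_def cinner_commute[symmetric])
  show "cinner (p + q) r = cinner p r + cinner q r"
    by (simp add: cinner_prod_def cinner_add_left)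
  show "cinner (c *\<^sub>C p) q = c * cinner p q"
    by (simp add: cinner_prod_def scaleC_prod_def cinner_scaleC_left distrib_left)
  show "inner p q = Re (cinner p q)"
    by (simp add: cinner_prod_def inner_prod_def inner_eq_Re_cinner)
qed

end

instance prod :: (chilbert_space, chilbert_space) chilbert_space ..


section \<open>Bounded operators\<close>

definition bounded_clinear :: "('a::complex_inner \<Rightarrow> 'b::complex_inner) \<Rightarrow> bool" where
  "bounded_clinear f \<longleftrightarrow> bounded_linear f \<and> (\<forall>c x. f (c *\<^sub>C x) = c *\<^sub>C f x)"

text \<open>\<open>'a bop\<close> is the algebra of bounded operators on \<open>'a\<close>. It is not made an instance of
  \<^class>\<open>ring_1\<close>, because \<open>0 = 1\<close> on the zero space.\<close>

typedef (overloaded) ('a::complex_inner) bop = "{f :: 'a \<Rightarrow> 'a. bounded_clinear f}"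
  morphisms apply_bop Bop
proof
  show "(\<lambda>_. 0) \<in> {f :: 'a \<Rightarrow> 'a. bounded_clinear f}"
    by (simp add: bounded_clinear_def scaleC_zero_right)
qed

setup_lifting type_definition_bop

notation apply_bop (infixr "*\<^sub>V" 75)

instantiation bop :: (complex_inner) "{ring, monoid_mult}"
begin

lift_definition zero_bop :: "'a bop" is "\<lambda>_. 0"
  by (simp add: bounded_clinear_def scaleC_zero_right)

lift_definition one_bop :: "'a bop" is "\<lambda>x. x"
  by (simp add: bounded_clinear_def bounded_linear_ident)

lift_definition plus_bop :: "'a bop \<Rightarrow> 'a bop \<Rightarrow> 'a bop" is "\<lambda>f g x. f x + g x"
  by (simp add: bounded_clinear_def bounded_linear_add scaleC_add_right)

lift_definition minus_bop :: "'a bop \<Rightarrow> 'a bop \<Rightarrow> 'a bop" is "\<lambda>f g x. f x - g x"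
  by (simp add: bounded_clinear_def bounded_linear_sub scaleC_diff_right)

lift_definition uminus_bop :: "'a bop \<Rightarrow> 'a bop" is "\<lambda>f x. - f x"
  by (simp add: bounded_clinear_def bounded_linear_minus scaleC_minus_right)

lift_definition times_bop :: "'a bop \<Rightarrow> 'a bop \<Rightarrow> 'a bop" is "\<lambda>f g x. f (g x)"
  by (simp add: bounded_clinear_def bounded_linear_compose)

instance
  by standard
    (transfer; simp add: fun_eq_iff algebra_simps bounded_clinear_def
      linear_add[OF bounded_linear.linear])+

end

definition adj :: "'a::chilbert_space bop \<Rightarrow> 'a bop" where
  "adj A = (THE B. \<forall>x y. cinner (A *\<^sub>V x) y = cinner x (B *\<^sub>V y))"

definition selfadjoint :: "'a::chilbert_space bop \<Rightarrow> bool" where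
  "selfadjoint A \<longleftrightarrow> adj A = A"

definition positive_op :: "'a::chilbert_space bop \<Rightarrow> bool" where
  "positive_op A \<longleftrightarrow> (\<forall>x. cinner (A *\<^sub>V x) x \<in> \<real>\<^sub>\<ge>\<^sub>0)"

definition loewner_le :: "'a::chilbert_space bop \<Rightarrow> 'a bop \<Rightarrow> bool" (infix "\<le>\<^sub>L" 50) where
  "A \<le>\<^sub>L B \<longleftrightarrow> selfadjoint A \<and> selfadjoint B \<and> positive_op (B - A)"

definition sqrt_op :: "'a::chilbert_space bop \<Rightarrow> 'a bop" where
  "sqrt_op P = (THE S. positive_op S \<and> S * S = P)"

definition abs_op :: "'a::chilbert_space bop \<Rightarrow> 'a bop" where
  "abs_op A = sqrt_op (adj A * A)"

definition ker_op :: "'a::chilbert_space bop \<Rightarrow> 'a set" where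
  "ker_op A = {x. A *\<^sub>V x = 0}"

text \<open>A partial isometry is isometric on the orthogonal complement of its kernel.\<close>

definition partial_isometry :: "'a::chilbert_space bop \<Rightarrow> bool" where
  "partial_isometry U \<longleftrightarrow>
    (\<forall>x. (\<forall>y\<in>ker_op U. cinner x y = 0) \<longrightarrow> norm (U *\<^sub>V x) = norm x)"

definition polar_decomposition :: "'a::chilbert_space bop \<Rightarrow> 'a bop \<Rightarrow> bool" where
  "polar_decomposition A U \<longleftrightarrow>
    partial_isometry U \<and> ker_op U = ker_op (abs_op A) \<and> A = U * abs_op A"


section \<open>Block matrices and the geometric mean\<close>

text \<open>\<open>block A B C D\<close> is the operator matrix with rows \<open>(A, B)\<close> and \<open>(C, D)\<close>. Every operator on the
  direct sum has this form for exactly one choice of the entries.\<close>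

lift_definition block ::
  "'a::chilbert_space bop \<Rightarrow> 'a bop \<Rightarrow> 'a bop \<Rightarrow> 'a bop \<Rightarrow> ('a \<times> 'a) bop"
  is "\<lambda>A B C D p. (A (fst p) + B (snd p), C (fst p) + D (snd p))"
  by (auto simp: bounded_clinear_def scaleC_prod_def scaleC_add_right
      intro!: bounded_linear_Pair bounded_linear_add
        bounded_linear_compose[OF _ bounded_linear_fst]
        bounded_linear_compose[OF _ bounded_linear_snd])

definition two_positive ::
  "('a::chilbert_space bop \<Rightarrow> 'b::chilbert_space bop) \<Rightarrow> bool" where
  "two_positive \<Phi> \<longleftrightarrow>
    (\<forall>A B C D. positive_op (block A B C D) \<longrightarrow> positive_op (block (\<Phi> A) (\<Phi> B) (\<Phi> C) (\<Phi> D)))"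

definition weakly_two_positive ::
  "('a::chilbert_space bop \<Rightarrow> 'b::chilbert_space bop) \<Rightarrow> bool" where
  "weakly_two_positive \<Phi> \<longleftrightarrow>
    (\<forall>A B C. positive_op (block A C C B) \<longrightarrow> positive_op (block (\<Phi> A) (\<Phi> C) (\<Phi> C) (\<Phi> B)))"

definition star_map ::
  "('a::chilbert_space bop \<Rightarrow> 'b::chilbert_space bop) \<Rightarrow> bool" where
  "star_map \<Phi> \<longleftrightarrow> (\<forall>A. \<Phi> (adj A) = adj (\<Phi> A))"

text \<open>The maximum exists, and \<open>A \<sharp> B\<close> is meaningful, for positive \<open>A\<close> and \<open>B\<close> only.\<close>

definition geometric_mean ::
  "'a::chilbert_space bop \<Rightarrow> 'a bop \<Rightarrow> 'a bop" (infixl "\<sharp>" 70) where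
  "A \<sharp> B =
    (let S = {X. selfadjoint X \<and> positive_op (block A X X B)}
     in THE M. M \<in> S \<and> (\<forall>X\<in>S. X \<le>\<^sub>L M))"

end

theory Submission
  imports Defs
begin

text \<open>
  Both inequalities say that an operator lies below a geometric mean \<open>P \<sharp> R\<close>. As \<open>P \<sharp> R\<close> is the
  greatest self-adjoint operator that can stand off the diagonal of a positive block matrix with diagonal
  \<open>P\<close>, \<open>R\<close>, it suffices to exhibit one positive block matrix (\<open>geometric_mean_upper\<close>).

  The starting point is the mixed Schwarz inequality, that the matrix with rows \<open>(|A|, A\<^sup>*)\<close> and
  \<open>(A, |A\<^sup>*|)\<close> is positive (\<open>positive_block_abs_op\<close>). For the first part, congruence by the diagonal
  matrix \<open>diag(X V, Y)\<close> puts \<open>V\<^sup>* X\<^sup>* A\<^sup>* Y = |X\<^sup>* A\<^sup>* Y|\<close> into both off-diagonal places, since \<open>V\<^sup>*\<close> undoes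
  the partial isometry \<open>V\<close> on the range of the absolute value (\<open>polar_decomposition_adj_times\<close>);
  a weakly 2-positive map preserves positivity of such a matrix. For the second part, congruence
  by \<open>diag(X, Y)\<close> comes first, then the 2-positive map, then congruence by \<open>diag(U, 1)\<close>, which
  turns the corner \<open>\<Phi>(X\<^sup>* A\<^sup>* Y)\<close> into its absolute value.

  The substance is that the maximum defining \<open>P \<sharp> R\<close> exists without any invertibility
  (\<open>geometric_mean_exists\<close>). Dividing out \<open>(P + R)\<^sup>1\<^sup>/\<^sup>2\<close> from both sides replaces \<open>P\<close> and \<open>R\<close> by the commuting
  pair \<open>D\<close> and \<open>1 - D\<close>, for which the maximum is the product of the square roots
  (\<open>commuting_block_le\<close>). The division is a Douglas factorisation (\<open>factor_through\<close>), a consequence of a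
  Riesz representation theorem for functionals on the range of an operator (\<open>riesz_range\<close>), which
  also supplies adjoints, polar factors and projections. Square roots are obtained by a monotone
  iteration (\<open>sqrt_one_minus\<close>).
\<close>

section \<open>Inner products and bounded operators\<close>

lemma cinner_add_right: "cinner x (y + z) = cinner x y + cinner x (z::'a::complex_inner)"
  by (metis cinner_commute cinner_add_left complex_cnj_add)

lemma cinner_scaleC_right: "cinner x (c *\<^sub>C y) = cnj c * cinner x (y::'a::complex_inner)"
  by (metis cinner_commute cinner_scaleC_left complex_cnj_mult)

lemma inner_scaleC_left: "inner (c *\<^sub>C x) y = inner x (cnj c *\<^sub>C (y::'a::complex_inner))"
  by (simp add: inner_eq_Re_cinner cinner_scaleC_left cinner_scaleC_right)

text \<open>Most of the argument runs in the underlying real inner product space: for complex-linear maps, an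
  identity between real inner products implies the complex one, because the imaginary parts are
  themselves real inner products.\<close>

lemma Im_cinner: "Im (cinner x y) = inner x (\<i> *\<^sub>C (y::'a::complex_inner))"
  by (simp add: inner_eq_Re_cinner cinner_scaleC_right)

lemma norm_scaleC: "norm (c *\<^sub>C x) = cmod c * norm (x::'a::complex_inner)"
proof -
  have "(norm (c *\<^sub>C x))\<^sup>2 = inner x (cnj c *\<^sub>C c *\<^sub>C x)"
    by (simp add: power2_norm_eq_inner inner_scaleC_left)
  also have "cnj c *\<^sub>C c *\<^sub>C x = (cmod c)\<^sup>2 *\<^sub>R x"
    using complex_norm_square[of c] by (simp add: scaleC_scaleC scaleR_scaleC mult.commute)
  finally have "(norm (c *\<^sub>C x))\<^sup>2 = (cmod c * norm x)\<^sup>2"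
    by (simp add: power2_norm_eq_inner[symmetric] power_mult_distrib)
  then show ?thesis by (simp add: power2_eq_iff_nonneg)
qed

lemma bounded_linear_scaleC: "bounded_linear (\<lambda>x::'a::complex_inner. c *\<^sub>C x)"
proof (rule bounded_linear_intro[where K = "cmod c"])
  show "c *\<^sub>C (r *\<^sub>R x) = r *\<^sub>R (c *\<^sub>C x)" for r and x :: 'a
    by (simp add: scaleR_scaleC scaleC_scaleC mult.commute)
qed (simp_all add: scaleC_add_right norm_scaleC)

lemma bounded_linear_apply_bop: "bounded_linear (apply_bop A)"
  using apply_bop[of A] by (simp add: bounded_clinear_def)

lemmas linear_apply_bop = bounded_linear.linear[OF bounded_linear_apply_bop]

lemma bop_scaleC: "A *\<^sub>V (c *\<^sub>C x) = c *\<^sub>C (A *\<^sub>V x)"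
  using apply_bop[of A] by (simp add: bounded_clinear_def)

lemmas bop_linear [simp] =
  linear_add[OF linear_apply_bop] linear_diff[OF linear_apply_bop]
  linear_neg[OF linear_apply_bop] linear_0[OF linear_apply_bop] linear_cmul[OF linear_apply_bop]

lemma continuous_on_apply_bop [continuous_intros]:
  "continuous_on T f \<Longrightarrow> continuous_on T (\<lambda>x. A *\<^sub>V f x)"
  by (rule bounded_linear.continuous_on[OF bounded_linear_apply_bop])

lemma tendsto_apply_bop: "(f \<longlongrightarrow> l) F \<Longrightarrow> ((\<lambda>n. A *\<^sub>V f n) \<longlongrightarrow> A *\<^sub>V l) F"
  by (rule bounded_linear.tendsto[OF bounded_linear_apply_bop])

lemma bop_bounded: obtains K where "K > 0" "\<And>x. norm (A *\<^sub>V x) \<le> K * norm x"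
  using bounded_linear.pos_bounded[OF bounded_linear_apply_bop, of A] by (metis mult.commute)

lemma bop_eqI: "(\<And>x. A *\<^sub>V x = B *\<^sub>V x) \<Longrightarrow> A = B"
  by (simp add: apply_bop_inject[symmetric] fun_eq_iff)

lemma bop_apply [simp]:
  "(A + B) *\<^sub>V x = A *\<^sub>V x + B *\<^sub>V x" "(A - B) *\<^sub>V x = A *\<^sub>V x - B *\<^sub>V x"
  "(A * B) *\<^sub>V x = A *\<^sub>V B *\<^sub>V x" "1 *\<^sub>V x = x" "0 *\<^sub>V x = 0"
  by (transfer, simp)+

lemma bop_of_function:
  fixes f :: "'a::complex_inner \<Rightarrow> 'a"
  assumes "\<And>x y. f (x + y) = f x + f y" "\<And>c x. f (c *\<^sub>C x) = c *\<^sub>C f x"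
    and "\<And>x. norm (f x) \<le> K * norm x"
  obtains T where "\<And>x. T *\<^sub>V x = f x"
proof -
  have "bounded_linear f"
    by (rule bounded_linear_intro[where K = K])
      (use assms in \<open>simp_all add: scaleR_scaleC mult.commute\<close>)
  then have "Bop f *\<^sub>V x = f x" for x
    using assms(2) by (subst Bop_inverse) (auto simp: bounded_clinear_def)
  then show thesis by (rule that)
qed

instantiation bop :: (complex_inner) real_vector
begin

lift_definition scaleR_bop :: "real \<Rightarrow> 'a bop \<Rightarrow> 'a bop" is "\<lambda>r f x. r *\<^sub>R f x"
  by (auto simp: bounded_clinear_def scaleR_scaleC scaleC_scaleC mult.commute
      intro!: bounded_linear_compose[OF bounded_linear_scaleC])

instance
  by standard (transfer; simp add: fun_eq_iff scaleR_add_right scaleR_add_left)+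

end

lemma scaleR_bop_apply [simp]: "(r *\<^sub>R A) *\<^sub>V x = r *\<^sub>R (A *\<^sub>V x)"
  by transfer simp

section \<open>Representing functionals on the range of an operator\<close>

text \<open>Minimising over \<open>t\<close>. This is the common source of the Cauchy--Schwarz inequalities for positive
  operators and positive block matrices, and of the first-order condition at a minimiser.\<close>

lemma quadratic_nonneg_discriminant:
  fixes a b d :: real
  assumes "0 \<le> d" and nonneg: "\<And>t. 0 \<le> a + 2 * t * b + t\<^sup>2 * d"
  shows "b\<^sup>2 \<le> a * d"
proof (cases "d = 0")
  case True
  have "b = 0"
  proof (rule ccontr)
    assume "b \<noteq> 0"
    then have "2 * (- (a + 1) / (2 * b)) * b = - (a + 1)" by simp
    then show False using nonneg[of "- (a + 1) / (2 * b)"] True by simp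
  qed
  with True show ?thesis by simp
next
  case False
  with \<open>0 \<le> d\<close> have "d > 0" by simp
  have "0 \<le> a + 2 * (- b / d) * b + (- b / d)\<^sup>2 * d" by (rule nonneg)
  also have "\<dots> = a - b\<^sup>2 / d" using \<open>d > 0\<close> by (simp add: field_simps power2_eq_square)
  finally show ?thesis using \<open>d > 0\<close> by (simp add: field_simps)
qed

text \<open>The Riesz representation theorem relative to the range of \<open>S\<close>, which need not be closed. The
  vector \<open>z\<close> is the limit of \<open>S u\<^sub>n\<close> along a sequence minimising \<open>\<parallel>S x\<parallel>\<^sup>2 - 2 g x\<close>. With \<open>S\<close> the
  identity this is the usual theorem and gives adjoints; other choices of \<open>S\<close> give factorisations,
  orthogonal projections and the solution of coercive equations.\<close>

lemma riesz_range:
  fixes S :: "'a::real_vector \<Rightarrow> 'b::{real_inner, complete_space}" and g :: "'a \<Rightarrow> real"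
  assumes S: "linear S" and g: "linear g" and bound: "\<And>x. \<bar>g x\<bar> \<le> c * norm (S x)"
  obtains z where "z \<in> closure (range S)" "\<And>x. g x = inner (S x) z"
proof -
  define \<phi> where "\<phi> x = (norm (S x))\<^sup>2 - 2 * g x" for x
  have lower: "- c\<^sup>2 \<le> \<phi> x" for x
  proof -
    have "0 \<le> (norm (S x) - c)\<^sup>2" by simp
    then show ?thesis using bound[of x] by (simp add: \<phi>_def power2_diff algebra_simps)
  qed
  then have bdd: "bdd_below (range \<phi>)" by (metis bdd_belowI2)
  define m where "m = Inf (range \<phi>)"
  have m: "m \<le> \<phi> x" for x unfolding m_def by (rule cInf_lower[OF _ bdd]) simp
  have "\<exists>x. \<phi> x < m + 1 / Suc n" for n
    using cInf_less_iff[of "range \<phi>" "m + 1 / Suc n"] bdd by (auto simp: m_def)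
  then obtain u where u: "\<phi> (u n) < m + 1 / Suc n" for n by metis
  have expand: "\<phi> (x + t *\<^sub>R y) = \<phi> x + 2 * t * (inner (S y) (S x) - g y) + t\<^sup>2 * (norm (S y))\<^sup>2"
    for x y t
    unfolding \<phi>_def power2_norm_eq_inner
    by (simp add: linear_add[OF S] linear_cmul[OF S] linear_add[OF g] linear_cmul[OF g]
        inner_left_distrib inner_right_distrib inner_commute algebra_simps power2_eq_square)
  \<comment> \<open>the parallelogram law makes every minimising sequence Cauchy\<close>
  have para: "(norm (S x - S y))\<^sup>2 = 2 * \<phi> x + 2 * \<phi> y - 4 * \<phi> ((1/2) *\<^sub>R (x + y))" for x y
    unfolding \<phi>_def power2_norm_eq_inner
    by (simp add: linear_add[OF S] linear_cmul[OF S] linear_add[OF g] linear_cmul[OF g]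
        inner_left_distrib inner_right_distrib inner_diff_left inner_diff_right inner_commute
        algebra_simps)
  have dist: "(norm (S (u i) - S (u j)))\<^sup>2 \<le> 2 / Suc i + 2 / Suc j" for i j
    using para[of "u i" "u j"] u[of i] u[of j] m[of "(1/2) *\<^sub>R (u i + u j)"] by simp
  have "Cauchy (\<lambda>n. S (u n))"
  proof (rule metric_CauchyI)
    fix e :: real assume e: "e > 0"
    then obtain n where n: "inverse (real (Suc n)) < e\<^sup>2 / 4"
      using reals_Archimedean[of "e\<^sup>2 / 4"] by auto
    have "dist (S (u i)) (S (u j)) < e" if "i \<ge> n" "j \<ge> n" for i j
    proof -
      have "2 / Suc i \<le> 2 * inverse (real (Suc n))" "2 / Suc j \<le> 2 * inverse (real (Suc n))"
        using that by (simp_all add: divide_simps)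
      then have "(norm (S (u i) - S (u j)))\<^sup>2 < e\<^sup>2" using dist[of i j] n by linarith
      then show ?thesis using e by (simp add: dist_norm power2_less_imp_less)
    qed
    then show "\<exists>N. \<forall>i\<ge>N. \<forall>j\<ge>N. dist (S (u i)) (S (u j)) < e" by blast
  qed
  then obtain z where z: "(\<lambda>n. S (u n)) \<longlonglongrightarrow> z" by (auto simp: Cauchy_convergent_iff convergent_def)
  have "g x = inner (S x) z" for x
  proof -
    define d where "d = inner (S x) z - g x"
    have quad: "0 \<le> 2 * t * d + t\<^sup>2 * (norm (S x))\<^sup>2" for t
    proof -
      have "(\<lambda>n. 1 / Suc n + 2 * t * (inner (S x) (S (u n)) - g x) + t\<^sup>2 * (norm (S x))\<^sup>2)
          \<longlonglongrightarrow> 0 + 2 * t * (inner (S x) z - g x) + t\<^sup>2 * (norm (S x))\<^sup>2"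
        by (intro tendsto_intros z LIMSEQ_Suc[OF lim_1_over_n])
      moreover have "0 \<le> 1 / Suc n + 2 * t * (inner (S x) (S (u n)) - g x) + t\<^sup>2 * (norm (S x))\<^sup>2" for n
        using m[of "u n + t *\<^sub>R x"] u[of n] expand[of "u n" t x] by linarith
      ultimately have "0 \<le> 0 + 2 * t * (inner (S x) z - g x) + t\<^sup>2 * (norm (S x))\<^sup>2"
        by (intro LIMSEQ_le_const) auto
      then show ?thesis by (simp add: d_def)
    qed
    have "d\<^sup>2 \<le> 0 * (norm (S x))\<^sup>2"
      by (rule quadratic_nonneg_discriminant) (use quad in simp_all)
    then show ?thesis by (simp add: d_def)
  qed
  moreover have "z \<in> closure (range S)"
    unfolding closure_sequential by (rule exI[of _ "\<lambda>n. S (u n)"]) (simp add: z)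
  ultimately show thesis using that by simp
qed

text \<open>This makes the representing vector unique: \<open>z\<close> is a limit of vectors orthogonal to \<open>z\<close>.\<close>

lemma orthogonal_closure_range_0:
  fixes S :: "'a \<Rightarrow> 'b::real_inner"
  assumes "z \<in> closure (range S)" "\<And>x. inner (S x) z = 0"
  shows "z = 0"
proof -
  have "closure (range S) \<subseteq> {w. inner w z = 0}"
    by (rule closure_minimal) (use assms(2) in \<open>auto intro!: closed_Collect_eq continuous_intros\<close>)
  then show ?thesis using assms(1) by auto
qed

lemma range_sequence:
  fixes S :: "'a \<Rightarrow> 'b::metric_space"
  assumes "x \<in> closure (range S)" obtains u where "(\<lambda>n. S (u n)) \<longlonglongrightarrow> x"
proof -
  obtain w where w: "\<And>n. w n \<in> range S" "w \<longlonglongrightarrow> x"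
    using assms unfolding closure_sequential by metis
  define u where "u n = inv S (w n)" for n
  have "(\<lambda>n. S (u n)) = w" by (simp add: u_def f_inv_into_f[OF w(1)])
  with w(2) that[of u] show thesis by simp
qed

lemma
  fixes S :: "'a::complex_inner bop"
  assumes "x \<in> closure (range (apply_bop S))" "y \<in> closure (range (apply_bop S))"
  shows closure_range_add: "x + y \<in> closure (range (apply_bop S))"
    and closure_range_diff: "x - y \<in> closure (range (apply_bop S))"
    and closure_range_scaleC: "c *\<^sub>C x \<in> closure (range (apply_bop S))"
proof -
  have mem: "l \<in> closure (range (apply_bop S))" if "(\<lambda>n. S *\<^sub>V w n) \<longlonglongrightarrow> l" for w l
    unfolding closure_sequential by (rule exI[of _ "\<lambda>n. S *\<^sub>V w n"]) (simp add: that)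
  obtain u v where u: "(\<lambda>n. S *\<^sub>V u n) \<longlonglongrightarrow> x" and v: "(\<lambda>n. S *\<^sub>V v n) \<longlonglongrightarrow> y"
    using range_sequence assms by metis
  show "x + y \<in> closure (range (apply_bop S))" using mem[of "\<lambda>n. u n + v n"] tendsto_add[OF u v] by simp
  show "x - y \<in> closure (range (apply_bop S))" using mem[of "\<lambda>n. u n - v n"] tendsto_diff[OF u v] by simp
  show "c *\<^sub>C x \<in> closure (range (apply_bop S))"
    using mem[of "\<lambda>n. c *\<^sub>C u n"] bounded_linear.tendsto[OF bounded_linear_scaleC u]
    by (simp add: bop_scaleC)
qed

text \<open>A factorisation in the style of Douglas: if \<open>R\<close> is dominated by \<open>S\<close>, then \<open>R = T\<^sup>* S\<close>. The vector \<open>T y\<close>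
  represents the functional \<open>R x \<mapsto> \<langle>R x, y\<rangle>\<close> read as a functional on the range of \<open>S\<close>; uniqueness of the
  representing vector in the closed range makes \<open>T\<close> linear.\<close>

lemma factor_through:
  fixes R S :: "'a::chilbert_space bop"
  assumes c: "0 \<le> c" and bound: "\<And>x y. \<bar>inner (R *\<^sub>V x) y\<bar> \<le> c * norm (S *\<^sub>V x) * norm y"
  obtains T where "\<And>x y. inner (R *\<^sub>V x) y = inner (S *\<^sub>V x) (T *\<^sub>V y)"
    "\<And>y. T *\<^sub>V y \<in> closure (range (apply_bop S))"
proof -
  let ?C = "closure (range (apply_bop S))"
  have "\<exists>z. z \<in> ?C \<and> (\<forall>x. inner (R *\<^sub>V x) y = inner (S *\<^sub>V x) z)" for y
  proof -
    have "linear (\<lambda>x. inner (R *\<^sub>V x) y)" by (rule linearI) (simp_all add: inner_left_distrib)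
    from riesz_range[OF linear_apply_bop[of S] this, of "c * norm y"] bound[of _ y] show ?thesis
      by (metis mult.assoc mult.commute)
  qed
  then obtain t where tC: "t y \<in> ?C" and t: "inner (R *\<^sub>V x) y = inner (S *\<^sub>V x) (t y)" for x y
    by metis
  have unique: "w = t y" if "w \<in> ?C" "\<And>x. inner (S *\<^sub>V x) w = inner (R *\<^sub>V x) y" for w y
    using orthogonal_closure_range_0[OF closure_range_diff[OF that(1) tC[of y]]] that(2) t
    by (simp add: inner_diff_right)
  have "t (x + y) = t x + t y" for x y
    by (rule unique[symmetric]) (simp_all add: closure_range_add tC t inner_right_distrib)
  moreover have "t (d *\<^sub>C y) = d *\<^sub>C t y" for d y
  proof (rule unique[symmetric])
    show "inner (S *\<^sub>V x) (d *\<^sub>C t y) = inner (R *\<^sub>V x) (d *\<^sub>C y)" for x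
      using t[of "cnj d *\<^sub>C x" y] by (simp add: bop_scaleC inner_scaleC_left)
  qed (rule closure_range_scaleC[OF tC tC])
  moreover have "norm (t y) \<le> c * norm y" for y
  proof -
    have "?C \<subseteq> {w. inner w (t y) \<le> c * norm w * norm y}"
      by (rule closure_minimal)
        (use t bound in \<open>auto intro!: closed_Collect_le continuous_intros simp flip: t
          intro: order_trans[OF abs_ge_self]\<close>)
    then have "norm (t y) * norm (t y) \<le> c * norm (t y) * norm y"
      using tC[of y] by (auto simp flip: power2_norm_eq_inner power2_eq_square)
    then have "t y \<noteq> 0 \<Longrightarrow> norm (t y) \<le> c * norm y"
      by (metis mult.assoc mult.commute mult_le_cancel_left_pos zero_less_norm_iff)
    then show ?thesis using c by (cases "t y = 0") auto
  qed
  ultimately obtain T where "\<And>x. T *\<^sub>V x = t x" using bop_of_function[of t c] by metis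
  then show thesis using that[of T] tC t by auto
qed

section \<open>Adjoints\<close>

text \<open>The adjoint is the factorisation of \<open>A\<close> through the identity.\<close>

lemma adj_exists: "\<exists>B. \<forall>x y. inner (A *\<^sub>V x) y = inner x (B *\<^sub>V (y::'a::chilbert_space))"
proof -
  obtain K where "K > 0" and K: "\<And>x. norm (A *\<^sub>V x) \<le> K * norm x" using bop_bounded[of A] by blast
  have "\<bar>inner (A *\<^sub>V x) y\<bar> \<le> K * norm (1 *\<^sub>V x) * norm y" for x y
    using order_trans[OF Cauchy_Schwarz_ineq2 mult_right_mono[OF K]] by simp
  from factor_through[OF less_imp_le[OF \<open>K > 0\<close>] this] show ?thesis by (metis bop_apply(4))
qed

lemma cinner_eq_iff: 
  fixes A B :: "'a::complex_inner bop"
  shows "(\<forall>x y. cinner (A *\<^sub>V x) y = cinner x (B *\<^sub>V y)) \<longleftrightarrow>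
   (\<forall>x y. inner (A *\<^sub>V x) y = inner x (B *\<^sub>V y))"
  unfolding complex_eq_iff Im_cinner inner_eq_Re_cinner[symmetric] by (simp add: bop_scaleC[symmetric], blast)

lemma bop_eqI_inner_right:
  fixes A B :: "'a::complex_inner bop"
  assumes "\<And>x y. inner x (A *\<^sub>V y) = inner x (B *\<^sub>V y)" shows "A = B"
proof (rule bop_eqI)
  fix y
  have "inner (A *\<^sub>V y - B *\<^sub>V y) (A *\<^sub>V y - B *\<^sub>V y) = 0"
    unfolding inner_diff_right assms by simp
  then show "A *\<^sub>V y = B *\<^sub>V y" by simp
qed

lemma adjoint_unique:
  fixes A B C :: "'a::complex_inner bop"
  assumes "\<And>x y. inner (A *\<^sub>V x) y = inner x (B *\<^sub>V y)"
    and "\<And>x y. inner (A *\<^sub>V x) y = inner x (C *\<^sub>V y)"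
  shows "B = C"
  by (rule bop_eqI_inner_right) (simp only: assms[symmetric])

lemma adj_inner: "inner (A *\<^sub>V x) y = inner x (adj A *\<^sub>V (y::'a::chilbert_space))"
proof -
  let ?P = "\<lambda>B. \<forall>x y. inner (A *\<^sub>V x) y = inner x (B *\<^sub>V (y::'a))"
  obtain B where B: "?P B" using adj_exists[of A] by blast
  have "?P (THE B. ?P B)"
  proof (rule theI)
    show "?P B" by (fact B)
  next
    fix C assume "?P C"
    with B show "C = B" by (intro adjoint_unique[of A]) simp_all
  qed
  then show ?thesis unfolding adj_def cinner_eq_iff by blast
qed

lemma adj_inner': "inner x (A *\<^sub>V y) = inner (adj A *\<^sub>V x) (y::'a::chilbert_space)"
  using adj_inner[of A y x] by (simp add: inner_commute)

lemma adj_eqI: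
  fixes A B :: "'a::chilbert_space bop"
  assumes "\<And>x y. inner (A *\<^sub>V x) y = inner x (B *\<^sub>V y)" shows "adj A = B"
  by (rule adjoint_unique[OF adj_inner assms])

lemma adj_adj [simp]: "adj (adj A) = A"
  by (rule adj_eqI) (simp only: adj_inner')

lemma adj_times [simp]: "adj (A * B) = adj B * adj A"
  by (rule adj_eqI) (simp add: adj_inner)

lemma selfadjoint_iff: 
  "selfadjoint A \<longleftrightarrow> (\<forall>x y. inner (A *\<^sub>V x) y = inner x (A *\<^sub>V y))"
  unfolding selfadjoint_def using adj_inner[of A] adj_eqI[of A A] by auto

lemma selfadjoint_inner: "selfadjoint A \<Longrightarrow> inner (A *\<^sub>V x) y = inner x (A *\<^sub>V y)"
  by (simp add: selfadjoint_iff)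

section \<open>Positive operators\<close>

text \<open>Over the complex numbers positivity forces self-adjointness, by polarisation: the form is real at
  \<open>\<i> *\<^sub>C x + y\<close>, \<open>x\<close> and \<open>y\<close>. For self-adjoint operators only the real part of the form matters.\<close>

lemma positive_op_iff:
  "positive_op T \<longleftrightarrow> selfadjoint T \<and> (\<forall>x. 0 \<le> inner (T *\<^sub>V x) x)"
proof
  assume T: "positive_op T"
  let ?f = "\<lambda>x y. cinner (T *\<^sub>V x) y"
  have Im: "Im (?f x x) = 0" for x
    using T by (auto simp: positive_op_def complex_nonneg_Reals_iff)
  have "Re (?f x y) = Re (?f y x)" for x y
    using Im[of "\<i> *\<^sub>C x + y"] Im[of x] Im[of y]
    by (simp add: bop_scaleC cinner_add_left cinner_add_right cinner_scaleC_left cinner_scaleC_right)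
  then have "selfadjoint T"
    unfolding selfadjoint_iff by (metis inner_eq_Re_cinner inner_commute)
  moreover have "0 \<le> inner (T *\<^sub>V x) x" for x
    using T by (auto simp: positive_op_def complex_nonneg_Reals_iff inner_eq_Re_cinner)
  ultimately show "selfadjoint T \<and> (\<forall>x. 0 \<le> inner (T *\<^sub>V x) x)" by blast
next
  assume T: "selfadjoint T \<and> (\<forall>x. 0 \<le> inner (T *\<^sub>V x) x)"
  have "inner (T *\<^sub>V x) (\<i> *\<^sub>C x) = 0" for x
  proof -
    have "inner (T *\<^sub>V x) (\<i> *\<^sub>C x) = inner x (\<i> *\<^sub>C (T *\<^sub>V x))"
      using T by (simp add: selfadjoint_iff bop_scaleC)
    also have "\<dots> = - inner (\<i> *\<^sub>C x) (T *\<^sub>V x)"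
      by (simp add: inner_eq_Re_cinner cinner_scaleC_left cinner_scaleC_right)
    finally show ?thesis by (simp add: inner_commute)
  qed
  then show "positive_op T"
    using T by (simp add: positive_op_def complex_nonneg_Reals_iff Im_cinner inner_eq_Re_cinner[symmetric])
qed

instance bop :: (complex_inner) real_algebra
  by standard (rule bop_eqI, simp)+

lemma positive_opI:
  "selfadjoint T \<Longrightarrow> (\<And>x. 0 \<le> inner (T *\<^sub>V x) x) \<Longrightarrow> positive_op T"
  by (simp add: positive_op_iff)

lemma positive_op_selfadjoint: "positive_op T \<Longrightarrow> selfadjoint T"
  by (simp add: positive_op_iff)

lemma positive_op_nonneg: "positive_op T \<Longrightarrow> 0 \<le> inner (T *\<^sub>V x) x"
  by (simp add: positive_op_iff)

lemmas positive_op_inner = selfadjoint_inner[OF positive_op_selfadjoint]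

lemma selfadjointI: "(\<And>x y. inner (T *\<^sub>V x) y = inner x (T *\<^sub>V y)) \<Longrightarrow> selfadjoint T"
  by (simp add: selfadjoint_iff)

lemma selfadjoint_one: "selfadjoint 1" and selfadjoint_zero: "selfadjoint 0"
  by (simp_all add: selfadjoint_iff)

lemma selfadjoint_add: "selfadjoint S \<Longrightarrow> selfadjoint T \<Longrightarrow> selfadjoint (S + T)"
  by (simp add: selfadjoint_iff inner_left_distrib inner_right_distrib)

lemma selfadjoint_diff: "selfadjoint S \<Longrightarrow> selfadjoint T \<Longrightarrow> selfadjoint (S - T)"
  by (simp add: selfadjoint_iff inner_diff_left inner_diff_right)

lemma selfadjoint_scaleR: "selfadjoint T \<Longrightarrow> selfadjoint (r *\<^sub>R T)"
  by (simp add: selfadjoint_iff)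

lemma selfadjoint_times: "selfadjoint S \<Longrightarrow> selfadjoint T \<Longrightarrow> S * T = T * S \<Longrightarrow> selfadjoint (S * T)"
  by (metis adj_times selfadjoint_def)

lemma positive_op_one: "positive_op 1"
  by (simp add: positive_op_iff selfadjoint_one)

lemma positive_op_add: "positive_op S \<Longrightarrow> positive_op T \<Longrightarrow> positive_op (S + T)"
  by (simp add: positive_op_iff selfadjoint_add inner_left_distrib)

lemma positive_op_scaleR: "positive_op T \<Longrightarrow> 0 \<le> r \<Longrightarrow> positive_op (r *\<^sub>R T)"
  by (simp add: positive_op_iff selfadjoint_scaleR)

lemma positive_op_conj: "positive_op T \<Longrightarrow> positive_op (adj C * T * C)"
  unfolding positive_op_iff selfadjoint_iff by (simp flip: adj_inner adj_inner') (metis inner_commute)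

lemma positive_op_adj_times: "positive_op (adj C * C)"
  using positive_op_conj[OF positive_op_one, of C] by simp

lemma positive_op_cauchy_schwarz:
  assumes "positive_op T"
  shows "(inner (T *\<^sub>V x) y)\<^sup>2 \<le> inner (T *\<^sub>V x) x * inner (T *\<^sub>V y) y"
proof (rule quadratic_nonneg_discriminant)
  fix t
  have "0 \<le> inner (T *\<^sub>V (x + t *\<^sub>R y)) (x + t *\<^sub>R y)" by (rule positive_op_nonneg[OF assms])
  also have "\<dots> = inner (T *\<^sub>V x) x + 2 * t * inner (T *\<^sub>V x) y + t\<^sup>2 * inner (T *\<^sub>V y) y"
    using positive_op_inner[OF assms, of y x]
    by (simp add: inner_left_distrib inner_right_distrib inner_commute power2_eq_square algebra_simps)
  finally show "0 \<le> \<dots>" .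
qed (rule positive_op_nonneg[OF assms])

text \<open>For positive \<open>T\<close> the form controls the norm of \<open>T x\<close>. This turns convergence of quadratic forms into
  strong convergence, and near-minimisers of a form into approximate eigenvectors.\<close>

lemma positive_op_norm_square_le:
  assumes "positive_op T" and K: "\<And>x. norm (T *\<^sub>V x) \<le> K * norm x"
  shows "(norm (T *\<^sub>V x))\<^sup>2 \<le> K * inner (T *\<^sub>V x) x"
proof (cases "T *\<^sub>V x = 0")
  case False
  have "((norm (T *\<^sub>V x))\<^sup>2)\<^sup>2 = (inner (T *\<^sub>V x) (T *\<^sub>V x))\<^sup>2" by (simp add: power2_norm_eq_inner)
  also have "\<dots> \<le> inner (T *\<^sub>V x) x * inner (T *\<^sub>V T *\<^sub>V x) (T *\<^sub>V x)"
    by (rule positive_op_cauchy_schwarz[OF assms(1)])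
  also have "\<dots> \<le> inner (T *\<^sub>V x) x * (K * (norm (T *\<^sub>V x))\<^sup>2)"
  proof (rule mult_left_mono[OF _ positive_op_nonneg[OF assms(1)]])
    show "inner (T *\<^sub>V T *\<^sub>V x) (T *\<^sub>V x) \<le> K * (norm (T *\<^sub>V x))\<^sup>2"
      using order_trans[OF norm_cauchy_schwarz mult_right_mono[OF K]]
      by (simp add: power2_eq_square mult.assoc)
  qed
  finally have "(norm (T *\<^sub>V x))\<^sup>2 * (norm (T *\<^sub>V x))\<^sup>2 \<le> (K * inner (T *\<^sub>V x) x) * (norm (T *\<^sub>V x))\<^sup>2"
    by (simp add: power2_eq_square mult_ac)
  then show ?thesis by (rule mult_right_le_imp_le) (use False in simp)
qed simp

lemma positive_op_form_zero:
  assumes "positive_op T" "inner (T *\<^sub>V x) x = 0" shows "T *\<^sub>V x = 0"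
proof -
  obtain K where "\<And>x. norm (T *\<^sub>V x) \<le> K * norm x" using bop_bounded[of T] by metis
  from positive_op_norm_square_le[OF assms(1) this, of x] show ?thesis using assms(2) by simp
qed

lemma selfadjoint_power: "selfadjoint X \<Longrightarrow> selfadjoint (X ^ n)"
  by (induction n) (simp_all add: selfadjoint_one selfadjoint_times power_commutes)

lemma positive_op_power:
  assumes "positive_op X" shows "positive_op (X ^ n)"
proof -
  have adj: "adj (X ^ k) = X ^ k" for k
    using selfadjoint_power[OF positive_op_selfadjoint[OF assms]] by (simp add: selfadjoint_def)
  show ?thesis
  proof (cases "even n")
    case True
    then obtain k where "n = k + k" by (auto simp: mult_2 elim!: evenE)
    then show ?thesis using positive_op_adj_times[of "X ^ k"] by (simp add: adj power_add)
  next
    case False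
    then obtain k where "n = k + 1 + k" by (auto simp: mult_2 elim!: oddE)
    then show ?thesis using positive_op_conj[OF assms, of "X ^ k"] by (simp only: adj power_add power_one_right)
  qed
qed

section \<open>Square roots\<close>

text \<open>The polynomials in \<open>X\<close> with nonnegative coefficients. They are closed under products and are
  positive whenever \<open>X\<close> is, so that products of commuting positive operators can be handled before
  square roots are available.\<close>

inductive nonneg_poly :: "'a::chilbert_space bop \<Rightarrow> 'a bop \<Rightarrow> bool" for X where
  nonneg_poly_power: "nonneg_poly X (X ^ n)"
| nonneg_poly_add: "nonneg_poly X S \<Longrightarrow> nonneg_poly X T \<Longrightarrow> nonneg_poly X (S + T)"
| nonneg_poly_scaleR: "0 \<le> r \<Longrightarrow> nonneg_poly X S \<Longrightarrow> nonneg_poly X (r *\<^sub>R S)"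

lemma nonneg_poly_times:
  assumes "nonneg_poly X S" "nonneg_poly X T" shows "nonneg_poly X (S * T)"
  using assms(1)
proof induction
  case (nonneg_poly_power n)
  from assms(2) show ?case
    by induction (simp_all add: nonneg_poly.intros distrib_left flip: power_add)
qed (simp_all add: nonneg_poly.intros distrib_right)

lemma nonneg_poly_commutes: "nonneg_poly X S \<Longrightarrow> C * X = X * C \<Longrightarrow> C * S = S * C"
  by (induction rule: nonneg_poly.induct) (simp_all add: power_commuting_commutes distrib_left distrib_right)

lemma nonneg_poly_positive: "nonneg_poly X S \<Longrightarrow> positive_op X \<Longrightarrow> positive_op S"
  by (induction rule: nonneg_poly.induct)
    (simp_all add: positive_op_power positive_op_add positive_op_scaleR)

text \<open>If \<open>Y = 1 - S\<close>, then \<open>S\<^sup>2 = 1 - X\<close> means \<open>Y = (X + Y\<^sup>2) / 2\<close>. The sequence below is the iteration of this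
  fixed point equation from \<open>0\<close>.\<close>

primrec sqrt_iter :: "'a::chilbert_space bop \<Rightarrow> nat \<Rightarrow> 'a bop" where
  "sqrt_iter X 0 = 0"
| "sqrt_iter X (Suc n) = (1/2) *\<^sub>R (X + sqrt_iter X n * sqrt_iter X n)"

lemma nonneg_poly_sqrt_iter: "nonneg_poly X (sqrt_iter X n)"
proof (induction n)
  case 0
  show ?case using nonneg_poly_scaleR[OF order_refl nonneg_poly_power] by simp
next
  case (Suc n)
  then show ?case
    using nonneg_poly_power[of X 1] by (simp add: nonneg_poly.intros nonneg_poly_times)
qed

text \<open>The iterates increase, because consecutive differences satisfy
  \<open>Y\<^sub>n\<^sub>+\<^sub>2 - Y\<^sub>n\<^sub>+\<^sub>1 = (Y\<^sub>n\<^sub>+\<^sub>1 - Y\<^sub>n) (Y\<^sub>n\<^sub>+\<^sub>1 + Y\<^sub>n) / 2\<close>: a product of polynomials with nonnegative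
  coefficients.\<close>

lemma nonneg_poly_sqrt_iter_diff: "nonneg_poly X (sqrt_iter X (Suc n) - sqrt_iter X n)"
proof (induction n)
  case 0
  show ?case using nonneg_poly_scaleR[OF _ nonneg_poly_power[of X 1], of "1/2"] by simp
next
  case (Suc n)
  let ?Y = "sqrt_iter X n" and ?Z = "sqrt_iter X (Suc n)"
  have "X * X = X * X" ..
  then have "?Z * X = X * ?Z" using nonneg_poly_commutes[OF nonneg_poly_sqrt_iter] by metis
  then have comm: "?Z * ?Y = ?Y * ?Z" by (rule nonneg_poly_commutes[OF nonneg_poly_sqrt_iter])
  have "sqrt_iter X (Suc (Suc n)) - ?Z = (1/2) *\<^sub>R (?Z * ?Z - ?Y * ?Y)"
    by (simp only: sqrt_iter.simps(2)[of X "Suc n"]) (simp add: algebra_simps)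
  also have "?Z * ?Z - ?Y * ?Y = (?Z - ?Y) * (?Z + ?Y)" using comm by (simp only: algebra_simps)
  finally show ?case
    using Suc by (simp only:) (intro nonneg_poly.intros nonneg_poly_times nonneg_poly_sqrt_iter, simp_all)
qed

text \<open>Cauchy--Schwarz for the form of \<open>X\<close>, applied to \<open>x\<close> and \<open>X x\<close>.\<close>

lemma positive_contraction_norm_le:
  assumes "positive_op X" "positive_op (1 - X)" shows "norm (X *\<^sub>V x) \<le> norm x"
proof -
  have le: "inner (X *\<^sub>V y) y \<le> (norm y)\<^sup>2" for y
    using positive_op_nonneg[OF assms(2), of y] by (simp add: inner_diff_left power2_norm_eq_inner)
  have "((norm (X *\<^sub>V x))\<^sup>2)\<^sup>2 = (inner (X *\<^sub>V x) (X *\<^sub>V x))\<^sup>2" by (simp add: power2_norm_eq_inner)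
  also have "\<dots> \<le> inner (X *\<^sub>V x) x * inner (X *\<^sub>V X *\<^sub>V x) (X *\<^sub>V x)"
    by (rule positive_op_cauchy_schwarz[OF assms(1)])
  also have "\<dots> \<le> (norm x)\<^sup>2 * (norm (X *\<^sub>V x))\<^sup>2"
    by (intro mult_mono le positive_op_nonneg[OF assms(1)]) simp
  finally have "(norm (X *\<^sub>V x))\<^sup>2 * (norm (X *\<^sub>V x))\<^sup>2 \<le> (norm x)\<^sup>2 * (norm (X *\<^sub>V x))\<^sup>2"
    by (simp add: power2_eq_square)
  then have "X *\<^sub>V x \<noteq> 0 \<Longrightarrow> (norm (X *\<^sub>V x))\<^sup>2 \<le> (norm x)\<^sup>2"
    by (rule mult_right_le_imp_le) simp
  then show ?thesis by (cases "X *\<^sub>V x = 0") (auto dest: power2_le_imp_le)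
qed

lemma norm_sqrt_iter_le:
  assumes X: "\<And>x. norm (X *\<^sub>V x) \<le> norm x" shows "norm (sqrt_iter X n *\<^sub>V x) \<le> norm x"
proof (induction n arbitrary: x)
  case (Suc n)
  have "norm (sqrt_iter X n *\<^sub>V sqrt_iter X n *\<^sub>V x) \<le> norm x" using Suc order_trans by blast
  with X[of x] show ?case using norm_triangle_ineq[of "X *\<^sub>V x" "sqrt_iter X n *\<^sub>V sqrt_iter X n *\<^sub>V x"] by simp
qed simp

text \<open>A bounded increasing sequence of positive operators converges strongly: the forms at \<open>x\<close> converge as
  real numbers, and they control the norms of the differences.\<close>

lemma sqrt_iter_Cauchy:
  assumes X: "positive_op X" "positive_op (1 - X)"
  shows "Cauchy (\<lambda>n. sqrt_iter X n *\<^sub>V x)"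
proof -
  let ?Y = "sqrt_iter X" and ?q = "\<lambda>n. inner (sqrt_iter X n *\<^sub>V x) x"
  have contr: "norm (?Y n *\<^sub>V v) \<le> norm v" for n v
    by (rule norm_sqrt_iter_le[OF positive_contraction_norm_le[OF X]])
  have mono: "positive_op (?Y m - ?Y n)" if "n \<le> m" for m n
    using that
  proof (induction m rule: dec_induct)
    case base
    show ?case by (simp add: positive_op_iff selfadjoint_zero)
  next
    case (step m)
    have "positive_op ((?Y m - ?Y n) + (?Y (Suc m) - ?Y m))"
      by (intro positive_op_add step nonneg_poly_positive[OF nonneg_poly_sqrt_iter_diff X(1)])
    also have "(?Y m - ?Y n) + (?Y (Suc m) - ?Y m) = ?Y (Suc m) - ?Y n"
      by (simp del: sqrt_iter.simps)
    finally show ?case .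
  qed
  have dist: "(norm (?Y m *\<^sub>V x - ?Y n *\<^sub>V x))\<^sup>2 \<le> 2 * (?q m - ?q n)" if "n \<le> m" for m n
  proof -
    have "norm ((?Y m - ?Y n) *\<^sub>V v) \<le> 2 * norm v" for v
      using norm_triangle_ineq4[of "?Y m *\<^sub>V v" "?Y n *\<^sub>V v"] contr[of m v] contr[of n v] by simp
    from positive_op_norm_square_le[OF mono[OF that] this, of x] show ?thesis
      by (simp add: inner_diff_left)
  qed
  have "?q n \<le> (norm x)\<^sup>2" for n
    using order_trans[OF norm_cauchy_schwarz mult_right_mono[OF contr]] by (simp add: power2_eq_square)
  moreover have "incseq ?q"
    using positive_op_nonneg[OF mono, of _ _ x] by (intro incseq_SucI) (simp add: inner_diff_left del: sqrt_iter.simps)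
  ultimately obtain L where "?q \<longlonglongrightarrow> L" using incseq_convergent[of ?q "(norm x)\<^sup>2"] by blast
  then have "Cauchy ?q" by (rule LIMSEQ_imp_Cauchy)
  show ?thesis
  proof (rule metric_CauchyI)
    fix e :: real assume e: "e > 0"
    then have "e\<^sup>2 / 2 > 0" by simp
    from metric_CauchyD[OF \<open>Cauchy ?q\<close> this]
    obtain N where N: "\<And>m n. m \<ge> N \<Longrightarrow> n \<ge> N \<Longrightarrow> dist (?q m) (?q n) < e\<^sup>2 / 2" by blast
    have close: "dist (?Y m *\<^sub>V x) (?Y n *\<^sub>V x) < e" if "n \<le> m" "N \<le> n" for m n
    proof -
      have "(norm (?Y m *\<^sub>V x - ?Y n *\<^sub>V x))\<^sup>2 < e\<^sup>2"
        using dist[OF that(1)] le_less_trans[OF abs_ge_self N[of m n, unfolded dist_real_def]] that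
        by fastforce
      then show ?thesis using e by (simp add: dist_norm power2_less_imp_less)
    qed
    have "dist (?Y m *\<^sub>V x) (?Y n *\<^sub>V x) < e" if "N \<le> m" "N \<le> n" for m n
      using close[of n m] close[of m n] that by (metis dist_commute nle_le)
    then show "\<exists>N. \<forall>m\<ge>N. \<forall>n\<ge>N. dist (?Y m *\<^sub>V x) (?Y n *\<^sub>V x) < e" by blast
  qed
qed

text \<open>The square root is \<open>1 - Y\<close> with \<open>Y\<close> the strong limit of the iteration. Each iterate is a polynomial
  in \<open>X\<close>, hence the limit commutes with everything that commutes with \<open>X\<close>.\<close>

lemma sqrt_one_minus:
  fixes X :: "'a::chilbert_space bop"
  assumes X: "positive_op X" "positive_op (1 - X)"
  obtains S where "positive_op S" "S * S = 1 - X" "\<And>C. C * X = X * C \<Longrightarrow> C * S = S * C"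
proof -
  let ?Y = "sqrt_iter X"
  have contr: "norm (?Y n *\<^sub>V v) \<le> norm v" for n v
    by (rule norm_sqrt_iter_le[OF positive_contraction_norm_le[OF X]])
  define y where "y x = lim (\<lambda>n. ?Y n *\<^sub>V x)" for x
  have y: "(\<lambda>n. ?Y n *\<^sub>V x) \<longlonglongrightarrow> y x" for x
    unfolding y_def using sqrt_iter_Cauchy[OF X, of x] by (simp add: Cauchy_convergent_iff convergent_LIMSEQ_iff)
  have "y (u + v) = y u + y v" for u v
    by (rule LIMSEQ_unique[OF y]) (use tendsto_add[OF y[of u] y[of v]] in simp)
  moreover have "y (c *\<^sub>C v) = c *\<^sub>C y v" for c v
    by (rule LIMSEQ_unique[OF y])
      (use bounded_linear.tendsto[OF bounded_linear_scaleC y[of v]] in \<open>simp add: bop_scaleC\<close>)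
  moreover have y_contr: "norm (y v) \<le> 1 * norm v" for v
    using LIMSEQ_le_const2[OF tendsto_norm[OF y[of v]], of "norm v"] contr by auto
  ultimately obtain Y where Yy: "\<And>x. Y *\<^sub>V x = y x" using bop_of_function[of y 1] by metis
  have Y: "(\<lambda>n. ?Y n *\<^sub>V x) \<longlonglongrightarrow> Y *\<^sub>V x" for x using y by (simp add: Yy)
  have sa: "selfadjoint Y"
  proof (rule selfadjointI)
    fix u v
    have "(\<lambda>n. inner (?Y n *\<^sub>V u) v) \<longlonglongrightarrow> inner (Y *\<^sub>V u) v" by (intro tendsto_intros Y)
    moreover have "(\<lambda>n. inner (?Y n *\<^sub>V u) v) \<longlonglongrightarrow> inner u (Y *\<^sub>V v)"
      unfolding positive_op_inner[OF nonneg_poly_positive[OF nonneg_poly_sqrt_iter X(1)]]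
      by (intro tendsto_intros Y)
    ultimately show "inner (Y *\<^sub>V u) v = inner u (Y *\<^sub>V v)" by (rule LIMSEQ_unique)
  qed
  have "(\<lambda>n. ?Y n *\<^sub>V ?Y n *\<^sub>V x) \<longlonglongrightarrow> Y *\<^sub>V Y *\<^sub>V x" for x
  proof -
    have "(\<lambda>n. norm (?Y n *\<^sub>V x - Y *\<^sub>V x)) \<longlonglongrightarrow> 0" using Y[of x] by (simp add: LIM_zero_iff tendsto_norm_zero)
    then have "(\<lambda>n. ?Y n *\<^sub>V (?Y n *\<^sub>V x - Y *\<^sub>V x)) \<longlonglongrightarrow> 0"
      by (rule Lim_null_comparison[OF always_eventually[OF allI[OF contr]]])
    from tendsto_add[OF this Y[of "Y *\<^sub>V x"]] show ?thesis by simp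
  qed
  then have "(\<lambda>n. ?Y (Suc n) *\<^sub>V x) \<longlonglongrightarrow> (1/2) *\<^sub>R (X *\<^sub>V x + Y *\<^sub>V Y *\<^sub>V x)" for x
    by (simp, intro tendsto_intros)
  then have fixpoint: "Y *\<^sub>V x = (1/2) *\<^sub>R (X *\<^sub>V x + Y *\<^sub>V Y *\<^sub>V x)" for x
    by (rule LIMSEQ_unique[OF LIMSEQ_Suc[OF Y]])
  have twice: "2 *\<^sub>R (Y *\<^sub>V x) = X *\<^sub>V x + Y *\<^sub>V Y *\<^sub>V x" for x
    using arg_cong[OF fixpoint[of x], of "\<lambda>v. 2 *\<^sub>R v"] by simp
  have square: "(1 - Y) * (1 - Y) = 1 - X"
  proof (rule bop_eqI)
    fix x
    have "((1 - Y) * (1 - Y)) *\<^sub>V x = x - 2 *\<^sub>R (Y *\<^sub>V x) + Y *\<^sub>V Y *\<^sub>V x"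
      by (simp add: algebra_simps scaleR_2)
    then show "((1 - Y) * (1 - Y)) *\<^sub>V x = (1 - X) *\<^sub>V x" unfolding twice by simp
  qed
  have pos: "positive_op (1 - Y)"
  proof (rule positive_opI)
    fix x
    have "inner (Y *\<^sub>V x) x \<le> norm x * norm x"
      using order_trans[OF norm_cauchy_schwarz mult_right_mono[OF y_contr[of x]]] by (simp add: Yy)
    then show "0 \<le> inner ((1 - Y) *\<^sub>V x) x"
      by (simp add: inner_diff_left power2_eq_square flip: power2_norm_eq_inner)
  qed (intro selfadjoint_diff selfadjoint_one sa)
  have comm: "C * (1 - Y) = (1 - Y) * C" if "C * X = X * C" for C
  proof -
    have "C *\<^sub>V Y *\<^sub>V x = Y *\<^sub>V C *\<^sub>V x" for x
    proof (rule LIMSEQ_unique[OF tendsto_apply_bop[OF Y]])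
      have "C * ?Y n = ?Y n * C" for n by (rule nonneg_poly_commutes[OF nonneg_poly_sqrt_iter that])
      then have "C *\<^sub>V ?Y n *\<^sub>V x = ?Y n *\<^sub>V C *\<^sub>V x" for n by (metis bop_apply(3))
      then show "(\<lambda>n. C *\<^sub>V ?Y n *\<^sub>V x) \<longlonglongrightarrow> Y *\<^sub>V C *\<^sub>V x" using Y[of "C *\<^sub>V x"] by simp
    qed
    then show ?thesis by (intro bop_eqI) simp
  qed
  show thesis by (rule that[OF pos square comm])
qed

text \<open>Rescaling a positive operator to norm at most one reduces to the form \<open>1 - X\<close>.\<close>

lemma sqrt_exists:
  fixes P :: "'a::chilbert_space bop"
  assumes P: "positive_op P"
  obtains S where "positive_op S" "S * S = P" "\<And>C. C * P = P * C \<Longrightarrow> C * S = S * C"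
proof -
  obtain K where K: "K > 0" "\<And>x. norm (P *\<^sub>V x) \<le> K * norm x" using bop_bounded[of P] by blast
  define X where "X = 1 - (1/K) *\<^sub>R P"
  have X: "positive_op X"
  proof (rule positive_opI)
    fix x
    have "inner (P *\<^sub>V x) x \<le> K * (norm x)\<^sup>2"
      using order_trans[OF norm_cauchy_schwarz mult_right_mono[OF K(2)[of x]]]
      by (simp add: power2_eq_square mult.assoc)
    then show "0 \<le> inner (X *\<^sub>V x) x"
      using K(1) by (simp add: X_def inner_diff_left divide_simps power2_norm_eq_inner mult.commute)
  qed (simp add: X_def selfadjoint_diff selfadjoint_one selfadjoint_scaleR positive_op_selfadjoint[OF P])
  have "positive_op (1 - X)" using K(1) by (simp add: X_def positive_op_scaleR P)
  from sqrt_one_minus[OF X this] obtain S where S: "positive_op S" "S * S = 1 - X" "\<And>C. C * X = X * C \<Longrightarrow> C * S = S * C"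
    by metis
  show thesis
  proof (rule that[of "sqrt K *\<^sub>R S"])
    show "positive_op (sqrt K *\<^sub>R S)" using K(1) by (simp add: positive_op_scaleR S(1))
    show "(sqrt K *\<^sub>R S) * (sqrt K *\<^sub>R S) = P" using K(1) S(2) by (simp add: X_def)
    show "C * (sqrt K *\<^sub>R S) = (sqrt K *\<^sub>R S) * C" if "C * P = P * C" for C
      using S(3)[of C] that by (simp add: X_def algebra_simps)
  qed
qed

text \<open>For \<open>z = (S - T) x\<close> the product \<open>(S + T) z\<close> vanishes. As both summands are positive, \<open>S z = T z = 0\<close>;
  hence \<open>(S - T)\<^sup>2 x = 0\<close> and so \<open>z = 0\<close>.\<close>

lemma sqrt_unique:
  fixes S T :: "'a::chilbert_space bop"
  assumes S: "positive_op S" and T: "positive_op T" and eq: "S * S = T * T" and comm: "S * T = T * S"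
  shows "S = T"
proof (rule bop_eqI)
  fix x
  define z where "z = (S - T) *\<^sub>V x"
  have "(S + T) * (S - T) = 0" using eq comm by (simp add: algebra_simps)
  then have "S *\<^sub>V z + T *\<^sub>V z = 0" unfolding z_def by (metis bop_apply(1,3,5))
  then have "inner (S *\<^sub>V z) z + inner (T *\<^sub>V z) z = 0" by (metis inner_left_distrib inner_zero_left)
  then have "inner (S *\<^sub>V z) z = 0" "inner (T *\<^sub>V z) z = 0"
    using positive_op_nonneg[OF S, of z] positive_op_nonneg[OF T, of z] by linarith+
  then have "(S - T) *\<^sub>V z = 0" using positive_op_form_zero[OF S, of z] positive_op_form_zero[OF T, of z] by simp
  then have "inner z z = 0"
    using selfadjoint_inner[OF selfadjoint_diff[OF S[THEN positive_op_selfadjoint] T[THEN positive_op_selfadjoint]], of x z]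
    by (simp add: z_def[symmetric] del: bop_apply)
  then show "S *\<^sub>V x = T *\<^sub>V x" by (simp add: z_def)
qed

lemma
  assumes P: "positive_op P"
  shows positive_sqrt_op: "positive_op (sqrt_op P)"
    and sqrt_op_square: "sqrt_op P * sqrt_op P = P"
    and sqrt_op_commutes: "C * P = P * C \<Longrightarrow> C * sqrt_op P = sqrt_op P * C"
    and sqrt_op_eqI: "positive_op S \<Longrightarrow> S * S = P \<Longrightarrow> sqrt_op P = S"
proof -
  obtain T where T: "positive_op T" "T * T = P" "\<And>C. C * P = P * C \<Longrightarrow> C * T = T * C"
    using sqrt_exists[OF P] by metis
  have unique: "S = T" if "positive_op S" "S * S = P" for S
  proof (rule sqrt_unique[OF that(1) T(1)])
    show "S * S = T * T" by (simp only: that(2) T(2))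
    show "S * T = T * S" by (rule T(3)) (metis that(2) mult.assoc)
  qed
  have "sqrt_op P = T" unfolding sqrt_op_def 
    by (rule the_equality) (simp_all add: T(1,2) unique)
  then show "positive_op (sqrt_op P)" "sqrt_op P * sqrt_op P = P"
    and "C * P = P * C \<Longrightarrow> C * sqrt_op P = sqrt_op P * C"
    and "positive_op S \<Longrightarrow> S * S = P \<Longrightarrow> sqrt_op P = S"
    using T(1,2) T(3)[of C] unique[of S] by simp_all
qed

section \<open>Absolute values and positive block matrices\<close>

lemma positive_abs_op: "positive_op (abs_op A)"
  and abs_op_square: "abs_op A * abs_op A = adj A * A"
  unfolding abs_op_def by (rule positive_sqrt_op sqrt_op_square, rule positive_op_adj_times)+

lemma selfadjoint_adj: "selfadjoint A \<Longrightarrow> adj A = A"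
  by (simp add: selfadjoint_def)

lemma adj_abs_op [simp]: "adj (abs_op A) = abs_op A"
  by (rule selfadjoint_adj[OF positive_op_selfadjoint[OF positive_abs_op]])

lemma inner_abs_op: "inner (abs_op A *\<^sub>V x) (abs_op A *\<^sub>V y) = inner (A *\<^sub>V x) (A *\<^sub>V y)"
proof -
  have "inner (abs_op A *\<^sub>V x) (abs_op A *\<^sub>V y) = inner x ((abs_op A * abs_op A) *\<^sub>V y)"
    using positive_op_inner[OF positive_abs_op] by simp
  then show ?thesis unfolding abs_op_square by (simp flip: adj_inner)
qed

lemma norm_abs_op: "norm (abs_op A *\<^sub>V x) = norm (A *\<^sub>V x)"
  by (simp add: norm_eq_sqrt_inner inner_abs_op)

text \<open>The factorisation of \<open>A\<close> through \<open>|A|\<close>, possible because \<open>\<parallel>A x\<parallel> = \<parallel>|A| x\<parallel>\<close>. The vectors \<open>U\<^sup>* A x\<close> and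
  \<open>|A| x\<close> both lie in the closed range of \<open>|A|\<close> and have the same inner products with it.\<close>

lemma polar_factor:
  fixes A :: "'a::chilbert_space bop"
  obtains U where "A = U * abs_op A" "adj U * A = abs_op A"
proof -
  have "\<bar>inner (A *\<^sub>V x) y\<bar> \<le> 1 * norm (abs_op A *\<^sub>V x) * norm y" for x y
    using Cauchy_Schwarz_ineq2 by (simp add: norm_abs_op)
  from factor_through[OF zero_le_one this]
  obtain T where T: "\<And>x y. inner (A *\<^sub>V x) y = inner (abs_op A *\<^sub>V x) (T *\<^sub>V y)"
    and TC: "\<And>y. T *\<^sub>V y \<in> closure (range (apply_bop (abs_op A)))" by metis
  have "adj A = abs_op A * T"
    by (rule adj_eqI) (simp add: T positive_op_inner[OF positive_abs_op])
  then have "adj (adj A) = adj T * abs_op A" by simp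
  then have "A = adj T * abs_op A" by simp
  moreover have "T * A = abs_op A"
  proof (rule bop_eqI)
    fix x
    have "abs_op A *\<^sub>V x \<in> closure (range (apply_bop (abs_op A)))"
      by (rule subsetD[OF closure_subset]) simp
    from closure_range_diff[OF TC this] have "T *\<^sub>V A *\<^sub>V x - abs_op A *\<^sub>V x = 0"
      by (rule orthogonal_closure_range_0) (simp add: inner_diff_right inner_abs_op flip: T)
    then show "(T * A) *\<^sub>V x = abs_op A *\<^sub>V x" by simp
  qed
  ultimately show thesis using that[of "adj T"] by simp
qed

text \<open>The right-hand side is positive, and its square is \<open>U |A|\<^sup>2 U\<^sup>* = A A\<^sup>*\<close>; uniqueness of positive square
  roots does the rest.\<close>

lemma abs_op_adj_polar:
  assumes "A = U * abs_op A" "adj U * A = abs_op A"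
  shows "abs_op (adj A) = U * abs_op A * adj U"
proof -
  have pos: "positive_op (A * adj A)" using positive_op_adj_times[of "adj A"] by simp
  have adjA: "adj A = abs_op A * adj U" using arg_cong[OF assms(1), of adj] by simp
  have "positive_op (U * abs_op A * adj U)" using positive_op_conj[OF positive_abs_op, of "adj U"] by simp
  moreover have "(U * abs_op A * adj U) * (U * abs_op A * adj U) = A * adj A"
  proof -
    have "(U * abs_op A * adj U) * (U * abs_op A * adj U) = A * (adj U * A) * adj U"
      using assms(1) by (metis mult.assoc)
    then show ?thesis by (simp only: assms(2) adjA mult.assoc)
  qed
  ultimately show ?thesis using sqrt_op_eqI[OF pos] by (simp add: abs_op_def)
qed

lemma block_apply [simp]:
  "block A B C D *\<^sub>V p = (A *\<^sub>V fst p + B *\<^sub>V snd p, C *\<^sub>V fst p + D *\<^sub>V snd p)"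
  by transfer simp

lemma positive_block_iff:
  "positive_op (block P Q R T) \<longleftrightarrow> selfadjoint P \<and> selfadjoint T \<and> adj Q = R \<and>
    (\<forall>x y. 0 \<le> inner (P *\<^sub>V x) x + 2 * inner (Q *\<^sub>V y) x + inner (T *\<^sub>V y) y)"
  (is "?lhs \<longleftrightarrow> ?rhs")
proof
  assume ?lhs
  have sa: "inner (block P Q R T *\<^sub>V p) q = inner p (block P Q R T *\<^sub>V q)" for p q
    by (rule positive_op_inner[OF \<open>?lhs\<close>])
  have R: "inner (Q *\<^sub>V y) x = inner y (R *\<^sub>V x)" for x y
    using sa[of "(0, y)" "(x, 0)"] by simp
  have "selfadjoint P" by (rule selfadjointI) (use sa[of "(_, 0)" "(_, 0)"] in simp)
  moreover have "selfadjoint T" by (rule selfadjointI) (use sa[of "(0, _)" "(0, _)"] in simp)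
  moreover have "adj Q = R" by (rule adj_eqI) (rule R)
  moreover have "0 \<le> inner (P *\<^sub>V x) x + 2 * inner (Q *\<^sub>V y) x + inner (T *\<^sub>V y) y" for x y
    using positive_op_nonneg[OF \<open>?lhs\<close>, of "(x, y)"] R[of y x] inner_commute[of y "R *\<^sub>V x"]
    by (simp add: inner_left_distrib)
  ultimately show ?rhs by blast
next
  assume ?rhs
  then have P: "selfadjoint P" and T: "selfadjoint T" and adjQ: "adj Q = R"
    and form: "0 \<le> inner (P *\<^sub>V x) x + 2 * inner (Q *\<^sub>V y) x + inner (T *\<^sub>V y) y" for x y
    by auto
  have R: "inner y (R *\<^sub>V x) = inner (Q *\<^sub>V y) x" for x y
    using adj_inner[of Q y x] by (simp add: adjQ)
  have R': "inner (R *\<^sub>V x) y = inner x (Q *\<^sub>V y)" for x y using R[of y x] by (simp add: inner_commute)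
  show ?lhs
  proof (rule positive_opI)
    show "selfadjoint (block P Q R T)"
      by (rule selfadjointI)
        (simp add: inner_prod_def inner_left_distrib inner_right_distrib R R'
          selfadjoint_inner[OF P] selfadjoint_inner[OF T])
    fix p :: "'a \<times> 'a"
    show "0 \<le> inner (block P Q R T *\<^sub>V p) p"
      using form[of "fst p" "snd p"] R'[of "fst p" "snd p"]
      by (simp add: inner_prod_def inner_left_distrib inner_right_distrib inner_commute)
  qed
qed

lemma selfadjoint_conj: "selfadjoint P \<Longrightarrow> selfadjoint (adj C * P * C)"
  by (simp add: selfadjoint_def mult.assoc)

text \<open>Congruence by the diagonal matrix with entries \<open>C\<close> and \<open>D\<close>.\<close>

lemma positive_block_conj:
  assumes "positive_op (block P Q R T)"
  shows "positive_op (block (adj C * P * C) (adj C * Q * D) (adj D * R * C) (adj D * T * D))"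
  using assms unfolding positive_block_iff
  by (auto simp: selfadjoint_conj simp flip: adj_inner' mult.assoc)

text \<open>The mixed Schwarz inequality. With \<open>A = U |A|\<close> the matrix is the congruence by \<open>diag(1, U\<^sup>*)\<close> of the
  matrix all of whose entries are \<open>|A|\<close>, and the form of the latter at \<open>(x, y)\<close> is
  \<open>\<langle>|A| (x + y), x + y\<rangle>\<close>.\<close>

lemma positive_block_abs_op: "positive_op (block (abs_op A) (adj A) A (abs_op (adj A)))"
proof -
  obtain U where U: "A = U * abs_op A" "adj U * A = abs_op A" by (rule polar_factor)
  have "positive_op (block (abs_op A) (abs_op A) (abs_op A) (abs_op A))"
  proof -
    have "0 \<le> inner (abs_op A *\<^sub>V x) x + 2 * inner (abs_op A *\<^sub>V y) x + inner (abs_op A *\<^sub>V y) y" for x y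
      using positive_op_nonneg[OF positive_abs_op, of A "x + y"] positive_op_inner[OF positive_abs_op, of A x y]
      by (simp add: inner_left_distrib inner_right_distrib inner_commute)
    then show ?thesis unfolding positive_block_iff
      using positive_op_selfadjoint[OF positive_abs_op] by simp
  qed
  from positive_block_conj[OF this, of 1 "adj U"]
  have "positive_op (block (abs_op A) (abs_op A * adj U) (U * abs_op A) (U * abs_op A * adj U))"
    by (simp add: selfadjoint_adj[OF selfadjoint_one])
  moreover have "abs_op A * adj U = adj A" using arg_cong[OF U(1), of adj] by simp
  ultimately show ?thesis by (simp only: abs_op_adj_polar[OF U] flip: U(1))
qed

text \<open>On the orthogonal complement \<open>M\<close> of its kernel \<open>U\<close> preserves norms, hence inner products. Since
  \<open>w = U\<^sup>* U x - x\<close> again lies in \<open>M\<close>, it follows that \<open>\<langle>w, w\<rangle> = 0\<close>.\<close>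

lemma partial_isometry_adj_apply:
  assumes U: "partial_isometry U" and x: "\<And>y. y \<in> ker_op U \<Longrightarrow> cinner x y = 0"
  shows "adj U *\<^sub>V U *\<^sub>V x = x"
proof -
  let ?M = "{x. \<forall>y\<in>ker_op U. cinner x y = 0}"
  have xM: "x \<in> ?M" using x by simp
  have norm: "norm (U *\<^sub>V v) = norm v" if "v \<in> ?M" for v
    using U that by (simp add: partial_isometry_def)
  have add: "v + w \<in> ?M" if "v \<in> ?M" "w \<in> ?M" for v w using that by (simp add: cinner_add_left)
  have inner: "inner (U *\<^sub>V v) (U *\<^sub>V w) = inner v w" if "v \<in> ?M" "w \<in> ?M" for v w
    using norm[OF that(1)] norm[OF that(2)] norm[OF add[OF that]] dot_norm[of v w]
      dot_norm[of "U *\<^sub>V v" "U *\<^sub>V w"] by simp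
  define w where "w = adj U *\<^sub>V U *\<^sub>V x - x"
  have adj_U: "cinner (adj U *\<^sub>V u) y = cinner u (U *\<^sub>V y)" for u y
    by (simp add: complex_eq_iff Im_cinner inner_eq_Re_cinner[symmetric] flip: adj_inner' bop_scaleC)
  have minus: "cinner (- u) y = - cinner u y" for u y :: 'a
    using cinner_scaleC_left[of "-1" u y] scaleR_scaleC[of "-1" u] by simp
  have "w \<in> ?M"
  proof (clarify)
    fix y assume y: "y \<in> ker_op U"
    have "cinner w y = cinner (adj U *\<^sub>V U *\<^sub>V x) y - cinner x y"
      unfolding w_def using cinner_add_left[of "adj U *\<^sub>V U *\<^sub>V x" "- x" y] minus[of x y] by simp
    also have "\<dots> = cinner (U *\<^sub>V x) 0" using y x by (simp add: adj_U ker_op_def)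
    also have "\<dots> = 0" using cinner_scaleC_right[of "U *\<^sub>V x" 0 0] by (simp add: scaleC_zero_right)
    finally show "cinner w y = 0" .
  qed
  then have "inner w w = 0"
    using inner[OF xM, of w] by (subst (1) w_def) (simp add: inner_diff_left flip: adj_inner')
  then show ?thesis by (simp add: w_def)
qed

text \<open>The range of \<open>|A|\<close> is orthogonal to its kernel, which is the kernel of \<open>U\<close>, so \<open>U\<^sup>* U\<close> fixes it.\<close>

lemma polar_decomposition_adj_times:
  assumes "polar_decomposition A U" shows "adj U * A = abs_op A"
proof (rule bop_eqI)
  fix x
  have U: "partial_isometry U" and ker: "ker_op U = ker_op (abs_op A)" and A: "A = U * abs_op A"
    using assms by (auto simp: polar_decomposition_def)
  have "cinner (abs_op A *\<^sub>V x) y = 0" if "y \<in> ker_op U" for y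
  proof -
    have "\<forall>x y. cinner (abs_op A *\<^sub>V x) y = cinner x (abs_op A *\<^sub>V y)"
      unfolding cinner_eq_iff using positive_op_inner[OF positive_abs_op] by blast
    moreover have "abs_op A *\<^sub>V y = 0" using that unfolding ker by (simp add: ker_op_def)
    ultimately have "cinner (abs_op A *\<^sub>V x) y = cinner x 0" by simp
    then show ?thesis using cinner_scaleC_right[of x 0 0] by (simp add: scaleC_zero_right)
  qed
  from partial_isometry_adj_apply[OF U this] show "(adj U * A) *\<^sub>V x = abs_op A *\<^sub>V x"
    using arg_cong[OF A, of "\<lambda>T. T *\<^sub>V x"] by simp
qed

section \<open>Block matrices with commuting entries\<close>

text \<open>If the form of \<open>N\<close> takes a negative value, then its infimum \<open>l\<close> over the unit sphere is a negative
  approximate eigenvalue: \<open>N - l\<close> is positive, and near-minimisers almost lie in its kernel.\<close>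

lemma selfadjoint_negative_approx_eigenvalue:
  fixes N :: "'a::chilbert_space bop"
  assumes N: "selfadjoint N" and neg: "inner (N *\<^sub>V w) w < 0"
  obtains l where "l < 0" "\<And>e. e > 0 \<Longrightarrow> \<exists>v. norm v = 1 \<and> norm (N *\<^sub>V v - l *\<^sub>R v) \<le> e"
proof -
  obtain K where K: "K > 0" "\<And>x. norm (N *\<^sub>V x) \<le> K * norm x" using bop_bounded[of N] by blast
  define R where "R = {inner (N *\<^sub>V v) v |v. norm v = 1}"
  define l where "l = Inf R"
  have "- K \<le> inner (N *\<^sub>V v) v" if "norm v = 1" for v
    using Cauchy_Schwarz_ineq2[of "N *\<^sub>V v" v] K(2)[of v] that by simp
  then have bdd: "bdd_below R" unfolding R_def by (intro bdd_belowI[of _ "- K"]) auto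
  have quot: "inner (N *\<^sub>V x) x / (norm x)\<^sup>2 \<in> R" if "x \<noteq> 0" for x
    unfolding R_def mem_Collect_eq
    by (rule exI[of _ "(1 / norm x) *\<^sub>R x"]) (use that in \<open>simp add: power2_eq_square\<close>)
  have "w \<noteq> 0" using neg by auto
  have l_neg: "l < 0"
    using cInf_lower[OF quot[OF \<open>w \<noteq> 0\<close>] bdd] neg \<open>w \<noteq> 0\<close>
    by (auto simp: l_def divide_less_0_iff elim!: le_less_trans)
  define T where "T = N - l *\<^sub>R 1"
  have T: "positive_op T"
  proof (rule positive_opI)
    fix x
    show "0 \<le> inner (T *\<^sub>V x) x"
    proof (cases "x = 0")
      case False
      then have "l \<le> inner (N *\<^sub>V x) x / (norm x)\<^sup>2" unfolding l_def by (intro cInf_lower quot bdd)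
      then have "l * (norm x)\<^sup>2 \<le> inner (N *\<^sub>V x) x" using False by (simp add: pos_le_divide_eq)
      then show ?thesis by (simp add: T_def inner_diff_left power2_norm_eq_inner)
    qed simp
  qed (simp add: T_def selfadjoint_diff selfadjoint_scaleR selfadjoint_one N)
  obtain L where L: "L > 0" "\<And>x. norm (T *\<^sub>V x) \<le> L * norm x" using bop_bounded[of T] by blast
  show thesis
  proof (rule that[OF l_neg])
    fix e :: real assume e: "e > 0"
    then have "l < l + e\<^sup>2 / L" using L(1) by simp
    moreover have "R \<noteq> {}" using quot[OF \<open>w \<noteq> 0\<close>] by blast
    ultimately obtain r where "r \<in> R" "r < l + e\<^sup>2 / L"
      using cInf_less_iff[OF _ bdd, of "l + e\<^sup>2 / L"] by (auto simp: l_def)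
    then obtain v where v: "norm v = 1" "inner (N *\<^sub>V v) v < l + e\<^sup>2 / L" by (auto simp: R_def)
    have "inner v v = 1" using v(1) by (simp flip: power2_norm_eq_inner)
    then have "inner (T *\<^sub>V v) v < e\<^sup>2 / L" using v(2) by (simp add: T_def inner_diff_left)
    then have "L * inner (T *\<^sub>V v) v < e\<^sup>2" using L(1) by (simp add: pos_less_divide_eq mult.commute)
    with positive_op_norm_square_le[OF T L(2), of v] have "(norm (T *\<^sub>V v))\<^sup>2 \<le> e\<^sup>2" by simp
    then have "norm (T *\<^sub>V v) \<le> e" by (rule power2_le_imp_le) (use e in simp)
    then show "\<exists>v. norm v = 1 \<and> norm (N *\<^sub>V v - l *\<^sub>R v) \<le> e" using v(1) by (auto simp: T_def)
  qed
qed

text \<open>Coercivity bounds \<open>\<langle>x, v\<rangle>\<close> by a multiple of \<open>\<parallel>b x\<parallel>\<close>, so a vector representing this functional on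
  the range of \<open>b\<close> solves the equation.\<close>

lemma coercive_surjective:
  fixes b :: "'a::chilbert_space bop"
  assumes b: "selfadjoint b" and e: "e > 0" and coer: "\<And>x. e * (norm x)\<^sup>2 \<le> inner (b *\<^sub>V x) x"
  obtains u where "b *\<^sub>V u = v"
proof -
  have lower: "e * norm x \<le> norm (b *\<^sub>V x)" for x
  proof (cases "x = 0")
    case False
    have "(e * norm x) * norm x \<le> norm (b *\<^sub>V x) * norm x"
      using coer[of x] norm_cauchy_schwarz[of "b *\<^sub>V x" x] by (simp add: power2_eq_square)
    then show ?thesis using False by simp
  qed simp
  have "linear (\<lambda>x. inner x v)" by (rule linearI) (simp_all add: inner_left_distrib)
  moreover have "\<bar>inner x v\<bar> \<le> (norm v / e) * norm (b *\<^sub>V x)" for x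
  proof -
    have "\<bar>inner x v\<bar> \<le> norm v * norm x" using Cauchy_Schwarz_ineq2[of x v] by (simp add: mult.commute)
    also have "\<dots> \<le> norm v * (norm (b *\<^sub>V x) / e)"
      using lower[of x] e by (intro mult_left_mono) (simp_all add: pos_le_divide_eq mult.commute)
    finally show ?thesis by simp
  qed
  ultimately obtain z where z: "\<And>x. inner x v = inner (b *\<^sub>V x) z"
    using riesz_range[OF linear_apply_bop[of b], of "\<lambda>x. inner x v" "norm v / e"] by metis
  have "b *\<^sub>V z = v"
  proof -
    have "inner (v - b *\<^sub>V z) (v - b *\<^sub>V z) = 0"
      unfolding inner_diff_right z selfadjoint_inner[OF b] by simp
    then show ?thesis by simp
  qed
  then show thesis by (rule that)
qed

text \<open>The square root \<open>r\<close> of \<open>b\<close> commutes with \<open>a\<close>, so that \<open>\<langle>a u, b u\<rangle> = \<langle>a r u, r u\<rangle>\<close>.\<close>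

lemma positive_commuting_product_lower_bound:
  assumes a: "positive_op a" and b: "positive_op b" and comm: "a * b = b * a" and e: "e > 0"
    and ca: "\<And>x. e * (norm x)\<^sup>2 \<le> inner (a *\<^sub>V x) x"
    and cb: "\<And>x. e * (norm x)\<^sup>2 \<le> inner (b *\<^sub>V x) x"
  shows "e\<^sup>2 * (norm u)\<^sup>2 \<le> inner (a *\<^sub>V u) (b *\<^sub>V u)"
proof -
  define r where "r = sqrt_op b"
  have r: "positive_op r" "r * r = b" "a * r = r * a"
    unfolding r_def by (fact positive_sqrt_op[OF b] sqrt_op_square[OF b] sqrt_op_commutes[OF b comm])+
  have rr: "r *\<^sub>V r *\<^sub>V x = b *\<^sub>V x" for x using r(2) by (metis bop_apply(3))
  have ar: "a *\<^sub>V r *\<^sub>V x = r *\<^sub>V a *\<^sub>V x" for x using r(3) by (metis bop_apply(3))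
  have "e * (e * (norm u)\<^sup>2) \<le> e * inner (b *\<^sub>V u) u" using cb e by (intro mult_left_mono) auto
  also have "inner (b *\<^sub>V u) u = (norm (r *\<^sub>V u))\<^sup>2"
    by (simp add: power2_norm_eq_inner positive_op_inner[OF r(1)] rr positive_op_inner[OF b])
  also have "e * (norm (r *\<^sub>V u))\<^sup>2 \<le> inner (a *\<^sub>V r *\<^sub>V u) (r *\<^sub>V u)" by (rule ca)
  also have "\<dots> = inner (a *\<^sub>V u) (b *\<^sub>V u)" by (simp add: ar positive_op_inner[OF r(1)] rr)
  finally show ?thesis by (simp add: power2_eq_square mult.assoc)
qed

text \<open>For commuting entries the block matrix with diagonal \<open>a\<^sup>2\<close>, \<open>b\<^sup>2\<close> allows at most \<open>a b\<close> off the
  diagonal. With \<open>N = a b - Z\<close>, the form at \<open>(- b u, a u)\<close> says \<open>\<langle>N b u, a u\<rangle> \<ge> 0\<close>. If \<open>N\<close> were not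
  positive, it would have an approximate eigenvector \<open>v = b u\<close> for some \<open>l < 0\<close>; then
  \<open>\<langle>N b u, a u\<rangle>\<close> is close to \<open>l \<langle>b u, a u\<rangle>\<close>, which coercivity keeps away from zero.\<close>

lemma commuting_block_le_coercive:
  fixes a b Z :: "'a::chilbert_space bop"
  assumes a: "positive_op a" and b: "positive_op b" and comm: "a * b = b * a" and Z: "selfadjoint Z"
    and e: "e > 0" and ca: "\<And>x. e * (norm x)\<^sup>2 \<le> inner (a *\<^sub>V x) x"
    and cb: "\<And>x. e * (norm x)\<^sup>2 \<le> inner (b *\<^sub>V x) x"
    and form: "\<And>x y. 0 \<le> (norm (a *\<^sub>V x))\<^sup>2 + 2 * inner (Z *\<^sub>V y) x + (norm (b *\<^sub>V y))\<^sup>2"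
  shows "inner (Z *\<^sub>V w) w \<le> inner (a *\<^sub>V b *\<^sub>V w) w"
proof (rule ccontr)
  define N where "N = a * b - Z"
  assume "\<not> ?thesis"
  then have neg: "inner (N *\<^sub>V w) w < 0" by (simp add: N_def inner_diff_left)
  have sa: "selfadjoint N"
    unfolding N_def by (intro selfadjoint_diff selfadjoint_times positive_op_selfadjoint a b comm Z)
  have ab: "b *\<^sub>V a *\<^sub>V x = a *\<^sub>V b *\<^sub>V x" for x using comm by (metis bop_apply(3))
  have N: "0 \<le> inner (N *\<^sub>V b *\<^sub>V u) (a *\<^sub>V u)" for u
  proof -
    have "inner (Z *\<^sub>V a *\<^sub>V u) (b *\<^sub>V u) \<le> (norm (a *\<^sub>V b *\<^sub>V u))\<^sup>2"
      using form[of "- (b *\<^sub>V u)" "a *\<^sub>V u"] by (simp add: ab)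
    also have "\<dots> = inner (a *\<^sub>V b *\<^sub>V a *\<^sub>V u) (b *\<^sub>V u)"
      by (simp add: power2_norm_eq_inner positive_op_inner[OF a] ab)
    finally have "0 \<le> inner (N *\<^sub>V a *\<^sub>V u) (b *\<^sub>V u)" by (simp add: N_def inner_diff_left)
    then show ?thesis by (metis selfadjoint_inner[OF sa] inner_commute)
  qed
  obtain l where l: "l < 0" "\<And>e. e > 0 \<Longrightarrow> \<exists>v. norm v = 1 \<and> norm (N *\<^sub>V v - l *\<^sub>R v) \<le> e"
    using selfadjoint_negative_approx_eigenvalue[OF sa neg] by metis
  obtain Ka where Ka: "Ka > 0" "\<And>x. norm (a *\<^sub>V x) \<le> Ka * norm x" using bop_bounded[of a] by blast
  obtain Kb where Kb: "Kb > 0" "\<And>x. norm (b *\<^sub>V x) \<le> Kb * norm x" using bop_bounded[of b] by blast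
  \<comment> \<open>half the threshold at which the error \<open>h Ka \<parallel>u\<parallel>\<close> reaches \<open>- l e\<^sup>2 \<parallel>u\<parallel>\<^sup>2\<close>, given \<open>\<parallel>u\<parallel> \<ge> 1 / Kb\<close>\<close>
  define h where "h = - l * e\<^sup>2 / (2 * Ka * Kb)"
  have "h > 0" unfolding h_def using l(1) e Ka(1) Kb(1) by (intro divide_pos_pos mult_pos_pos) auto
  then obtain v where v: "norm v = 1" "norm (N *\<^sub>V v - l *\<^sub>R v) \<le> h" using l(2) by blast
  obtain u where u: "b *\<^sub>V u = v" by (rule coercive_surjective[OF positive_op_selfadjoint[OF b] e cb])
  have u_lower: "1 \<le> Kb * norm u" using Kb(2)[of u] v(1) u by simp
  have "inner (N *\<^sub>V v - l *\<^sub>R v) (a *\<^sub>V u) \<le> h * (Ka * norm u)"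
    using order_trans[OF norm_cauchy_schwarz mult_mono[OF v(2) Ka(2)]] \<open>h > 0\<close> by simp
  moreover have "0 \<le> inner (N *\<^sub>V v - l *\<^sub>R v) (a *\<^sub>V u) + l * inner (a *\<^sub>V u) (b *\<^sub>V u)"
    using N[of u] by (simp add: u inner_diff_left inner_commute[of _ v])
  moreover have "l * inner (a *\<^sub>V u) (b *\<^sub>V u) \<le> l * (e\<^sup>2 * (norm u)\<^sup>2)"
    using positive_commuting_product_lower_bound[OF a b comm e ca cb, of u] l(1)
    by (simp add: mult_left_mono_neg)
  ultimately have "0 \<le> h * (Ka * norm u) + l * (e\<^sup>2 * (norm u)\<^sup>2)" by linarith
  also have "\<dots> = norm u * (- l) * e\<^sup>2 * (1 / (2 * Kb) - norm u)"
    using Ka(1) Kb(1) by (simp add: h_def field_simps power2_eq_square)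
  also have "\<dots> < 0"
  proof (rule mult_pos_neg)
    have "norm u > 0" using u_lower Kb(1) by (cases "u = 0") auto
    then show "norm u * (- l) * e\<^sup>2 > 0" using l(1) e by (intro mult_pos_pos) auto
    have "1 / (2 * Kb) < 1 / Kb" using Kb(1) by (simp add: field_simps)
    also have "1 / Kb \<le> norm u" using u_lower Kb(1) by (simp add: field_simps)
    finally show "1 / (2 * Kb) - norm u < 0" by simp
  qed
  finally show False by simp
qed

text \<open>The coercive case applied to \<open>a + e\<close> and \<open>b + e\<close>, followed by \<open>e \<rightarrow> 0\<close>.\<close>

lemma commuting_block_le:
  fixes a b Z :: "'a::chilbert_space bop"
  assumes a: "positive_op a" and b: "positive_op b" and comm: "a * b = b * a" and Z: "selfadjoint Z"
    and form: "\<And>x y. 0 \<le> (norm (a *\<^sub>V x))\<^sup>2 + 2 * inner (Z *\<^sub>V y) x + (norm (b *\<^sub>V y))\<^sup>2"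
  shows "inner (Z *\<^sub>V w) w \<le> inner (a *\<^sub>V b *\<^sub>V w) w"
proof -
  have shift: "positive_op (c + e *\<^sub>R 1)" "e * (norm x)\<^sup>2 \<le> inner ((c + e *\<^sub>R 1) *\<^sub>V x) x"
    "(norm (c *\<^sub>V x))\<^sup>2 \<le> (norm ((c + e *\<^sub>R 1) *\<^sub>V x))\<^sup>2"
    if "positive_op c" "e > 0" for c :: "'a bop" and e x
  proof -
    note nonneg = positive_op_nonneg[OF that(1), of x]
    show "positive_op (c + e *\<^sub>R 1)"
      using that by (intro positive_op_add positive_op_scaleR positive_op_one) auto
    show "e * (norm x)\<^sup>2 \<le> inner ((c + e *\<^sub>R 1) *\<^sub>V x) x"
      using nonneg by (simp add: inner_left_distrib power2_norm_eq_inner)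
    have "(norm ((c + e *\<^sub>R 1) *\<^sub>V x))\<^sup>2 = (norm (c *\<^sub>V x))\<^sup>2 + 2 * e * inner (c *\<^sub>V x) x + e\<^sup>2 * (norm x)\<^sup>2"
      unfolding power2_norm_eq_inner
      by (simp add: inner_left_distrib inner_right_distrib inner_commute power2_eq_square)
    then show "(norm (c *\<^sub>V x))\<^sup>2 \<le> (norm ((c + e *\<^sub>R 1) *\<^sub>V x))\<^sup>2" using nonneg that(2) by simp
  qed
  have le: "inner (Z *\<^sub>V w) w
      \<le> inner (a *\<^sub>V b *\<^sub>V w) w + e * (inner (a *\<^sub>V w) w + inner (b *\<^sub>V w) w) + e\<^sup>2 * (norm w)\<^sup>2"
    if e: "e > 0" for e
  proof -
    have "(a + e *\<^sub>R 1) * (b + e *\<^sub>R 1) = (b + e *\<^sub>R 1) * (a + e *\<^sub>R 1)"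
      using comm by (simp add: algebra_simps)
    moreover have "0 \<le> (norm ((a + e *\<^sub>R 1) *\<^sub>V x))\<^sup>2 + 2 * inner (Z *\<^sub>V y) x + (norm ((b + e *\<^sub>R 1) *\<^sub>V y))\<^sup>2" for x y
      using form[of x y] shift(3)[OF a e, of x] shift(3)[OF b e, of y] by linarith
    ultimately have "inner (Z *\<^sub>V w) w \<le> inner ((a + e *\<^sub>R 1) *\<^sub>V (b + e *\<^sub>R 1) *\<^sub>V w) w"
      by (intro commuting_block_le_coercive[OF shift(1)[OF a e] shift(1)[OF b e] _ Z e]
          shift(2)[OF a e] shift(2)[OF b e])
    then show ?thesis unfolding power2_norm_eq_inner
      by (simp add: inner_left_distrib power2_eq_square algebra_simps)
  qed
  let ?c = "\<lambda>e. inner (a *\<^sub>V b *\<^sub>V w) w + e * (inner (a *\<^sub>V w) w + inner (b *\<^sub>V w) w) + e\<^sup>2 * (norm w)\<^sup>2"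
  have "(\<lambda>n. ?c (1 / real (Suc n))) \<longlonglongrightarrow> ?c 0" by (intro tendsto_intros LIMSEQ_Suc[OF lim_1_over_n])
  then have "inner (Z *\<^sub>V w) w \<le> ?c 0" by (rule LIMSEQ_le_const) (intro exI allI impI le, simp)
  then show ?thesis by simp
qed

section \<open>Existence of the geometric mean\<close>

lemma closure_range_closed_relation:
  fixes S :: "'a::chilbert_space bop"
  assumes "closed {p. Q (fst p) (snd p)}" and "\<And>u v. Q (S *\<^sub>V u) (S *\<^sub>V v)"
    and "x \<in> closure (range (apply_bop S))" "y \<in> closure (range (apply_bop S))"
  shows "Q x y"
proof -
  have "closure (range (apply_bop S) \<times> range (apply_bop S)) \<subseteq> {p. Q (fst p) (snd p)}"
    by (rule closure_minimal) (use assms(1,2) in auto)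
  then show ?thesis using assms(3,4) by (auto simp: closure_Times)
qed

text \<open>\<open>P\<close> is the orthogonal projection onto the closed range: it comes from the factorisation of \<open>S\<close>
  through itself.\<close>

lemma projection_closure_range:
  fixes S :: "'a::chilbert_space bop"
  obtains P where "\<And>y. P *\<^sub>V y \<in> closure (range (apply_bop S))"
    "\<And>v y. v \<in> closure (range (apply_bop S)) \<Longrightarrow> inner v (P *\<^sub>V y) = inner v y"
proof -
  have "\<bar>inner (S *\<^sub>V x) y\<bar> \<le> 1 * norm (S *\<^sub>V x) * norm y" for x y
    using Cauchy_Schwarz_ineq2 by simp
  from factor_through[OF zero_le_one this]
  obtain P where P: "\<And>x y. inner (S *\<^sub>V x) y = inner (S *\<^sub>V x) (P *\<^sub>V y)"
    and PC: "\<And>y. P *\<^sub>V y \<in> closure (range (apply_bop S))" by metis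
  have "inner v (P *\<^sub>V y) = inner v y" if "v \<in> closure (range (apply_bop S))" for v y
  proof (rule closure_range_closed_relation[where Q = "\<lambda>v _. inner v (P *\<^sub>V y) = inner v y", OF _ _ that that])
    show "inner (S *\<^sub>V u) (P *\<^sub>V y) = inner (S *\<^sub>V u) y" for u by (rule P[symmetric])
  qed (intro closed_Collect_eq continuous_intros)
  then show thesis using that PC by blast
qed

text \<open>A form bounded by \<open>\<parallel>S x\<parallel> \<parallel>S y\<parallel>\<close> is \<open>\<langle>Z S x, S y\<rangle>\<close> for an operator \<open>Z\<close> living on the closed range of
  \<open>S\<close>, that is, with \<open>Z = P Z P\<close>. Two factorisations through \<open>S\<close> are needed, one for each argument.\<close>

lemma compression:
  fixes S X :: "'a::chilbert_space bop"
  assumes bound: "\<And>x y. \<bar>inner (X *\<^sub>V x) y\<bar> \<le> norm (S *\<^sub>V x) * norm (S *\<^sub>V y)"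
    and PC: "\<And>y. P *\<^sub>V y \<in> closure (range (apply_bop S))"
    and P: "\<And>v y. v \<in> closure (range (apply_bop S)) \<Longrightarrow> inner v (P *\<^sub>V y) = inner v y"
  obtains Z where "\<And>x y. inner (X *\<^sub>V x) y = inner (Z *\<^sub>V S *\<^sub>V x) (S *\<^sub>V y)"
    "\<And>x y. inner (Z *\<^sub>V x) y = inner (Z *\<^sub>V P *\<^sub>V x) (P *\<^sub>V y)"
proof -
  let ?C = "closure (range (apply_bop S))"
  obtain K where K: "K > 0" "\<And>x. norm (S *\<^sub>V x) \<le> K * norm x" using bop_bounded[of S] by blast
  have "\<bar>inner (X *\<^sub>V x) y\<bar> \<le> K * norm (S *\<^sub>V x) * norm y" for x y
    using order_trans[OF bound mult_left_mono[OF K(2) norm_ge_zero]] by (simp add: mult_ac)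
  from factor_through[OF less_imp_le[OF K(1)] this]
  obtain L where L: "\<And>x y. inner (X *\<^sub>V x) y = inner (S *\<^sub>V x) (L *\<^sub>V y)"
    and LC: "\<And>y. L *\<^sub>V y \<in> ?C" by metis
  have L_bound: "norm (L *\<^sub>V y) \<le> norm (S *\<^sub>V y)" for y
  proof -
    have "inner (L *\<^sub>V y) (L *\<^sub>V y) \<le> norm (L *\<^sub>V y) * norm (S *\<^sub>V y)"
    proof (rule closure_range_closed_relation[where Q = "\<lambda>v _. inner v (L *\<^sub>V y) \<le> norm v * norm (S *\<^sub>V y)",
          OF _ _ LC LC])
      show "inner (S *\<^sub>V u) (L *\<^sub>V y) \<le> norm (S *\<^sub>V u) * norm (S *\<^sub>V y)" for u
        using order_trans[OF abs_ge_self bound] by (simp flip: L)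
    qed (intro closed_Collect_le continuous_intros)
    then show ?thesis
      by (cases "L *\<^sub>V y = 0") (simp_all flip: power2_norm_eq_inner add: power2_eq_square)
  qed
  have "\<bar>inner (L *\<^sub>V x) y\<bar> \<le> 1 * norm (S *\<^sub>V x) * norm y" for x y
    using order_trans[OF Cauchy_Schwarz_ineq2 mult_right_mono[OF L_bound norm_ge_zero]] by simp
  from factor_through[OF zero_le_one this]
  obtain Z where Z: "\<And>x y. inner (L *\<^sub>V x) y = inner (S *\<^sub>V x) (Z *\<^sub>V y)"
    and ZC: "\<And>y. Z *\<^sub>V y \<in> ?C" by metis
  have "inner (X *\<^sub>V x) y = inner (Z *\<^sub>V S *\<^sub>V x) (S *\<^sub>V y)" for x y
    using L[of x y] Z[of y "S *\<^sub>V x"] by (simp add: inner_commute)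
  moreover have "Z *\<^sub>V P *\<^sub>V x = Z *\<^sub>V x" for x
  proof -
    have "Z *\<^sub>V P *\<^sub>V x - Z *\<^sub>V x = 0"
    proof (rule orthogonal_closure_range_0[OF closure_range_diff[OF ZC ZC]])
      show "inner (S *\<^sub>V u) (Z *\<^sub>V P *\<^sub>V x - Z *\<^sub>V x) = 0" for u
        using P[OF LC[of u], of x] by (simp add: inner_diff_right flip: Z)
    qed
    then show ?thesis by simp
  qed
  then have "inner (Z *\<^sub>V x) y = inner (Z *\<^sub>V P *\<^sub>V x) (P *\<^sub>V y)" for x y
    using P[OF ZC] by simp
  ultimately show thesis using that by blast
qed

lemma positive_block_cauchy_schwarz:
  assumes "positive_op (block A X X B)"
  shows "\<bar>inner (X *\<^sub>V x) y\<bar> \<le> sqrt (inner (A *\<^sub>V y) y) * sqrt (inner (B *\<^sub>V x) x)"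
proof -
  have form: "0 \<le> inner (A *\<^sub>V u) u + 2 * inner (X *\<^sub>V v) u + inner (B *\<^sub>V v) v" for u v
    using assms by (simp add: positive_block_iff)
  have "(inner (X *\<^sub>V x) y)\<^sup>2 \<le> inner (A *\<^sub>V y) y * inner (B *\<^sub>V x) x"
  proof (rule quadratic_nonneg_discriminant)
    show "0 \<le> inner (B *\<^sub>V x) x" using form[of 0 x] by simp
    show "0 \<le> inner (A *\<^sub>V y) y + 2 * t * inner (X *\<^sub>V x) y + t\<^sup>2 * inner (B *\<^sub>V x) x" for t
      using form[of y "t *\<^sub>R x"] by (simp add: power2_eq_square mult.assoc)
  qed
  from real_sqrt_le_mono[OF this] show ?thesis by (simp add: real_sqrt_mult)
qed

text \<open>The construction of Pusz and Woronowicz. Put \<open>S = (A + B)\<^sup>1\<^sup>/\<^sup>2\<close> and compress: \<open>A = S D S\<close> with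
  \<open>0 \<le> D \<le> 1\<close>, and then \<open>B = S (1 - D) S\<close>. The two middle factors commute, so their geometric mean is
  the product \<open>a b\<close> of their square roots, and \<open>M = S a b S\<close>. Any competitor \<open>X\<close> satisfies
  \<open>|\<langle>X x, y\<rangle>| \<le> \<parallel>S x\<parallel> \<parallel>S y\<parallel>\<close>, so it is a compression \<open>S Z S\<close> as well, and the commuting case bounds
  \<open>Z\<close> by \<open>a b\<close>.\<close>

lemma geometric_mean_exists:
  fixes A B :: "'a::chilbert_space bop"
  assumes A: "positive_op A" and B: "positive_op B"
  obtains M where "selfadjoint M" "positive_op (block A M M B)"
    "\<And>X x. selfadjoint X \<Longrightarrow> positive_op (block A X X B) \<Longrightarrow> inner (X *\<^sub>V x) x \<le> inner (M *\<^sub>V x) x"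
proof -
  define S where "S = sqrt_op (A + B)"
  have AB: "positive_op (A + B)" by (rule positive_op_add[OF A B])
  have S: "positive_op S" unfolding S_def by (rule positive_sqrt_op[OF AB])
  have SS: "inner (S *\<^sub>V x) (S *\<^sub>V y) = inner (A *\<^sub>V x) y + inner (B *\<^sub>V x) y" for x y
  proof -
    have "inner (S *\<^sub>V x) (S *\<^sub>V y) = inner ((S * S) *\<^sub>V x) y" by (simp add: positive_op_inner[OF S])
    then show ?thesis unfolding S_def sqrt_op_square[OF AB] by (simp add: inner_left_distrib)
  qed
  have normS: "norm (S *\<^sub>V x) = sqrt (inner (A *\<^sub>V x) x + inner (B *\<^sub>V x) x)" for x
    by (simp add: norm_eq_sqrt_inner SS)
  have A_le: "sqrt (inner (A *\<^sub>V x) x) \<le> norm (S *\<^sub>V x)" and B_le: "sqrt (inner (B *\<^sub>V x) x) \<le> norm (S *\<^sub>V x)" for x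
    using positive_op_nonneg[OF A, of x] positive_op_nonneg[OF B, of x] by (simp_all add: normS)
  obtain P where PC: "\<And>y. P *\<^sub>V y \<in> closure (range (apply_bop S))"
    and P: "\<And>v y. v \<in> closure (range (apply_bop S)) \<Longrightarrow> inner v (P *\<^sub>V y) = inner v y"
    using projection_closure_range[of S] by metis
  \<comment> \<open>identities and inequalities for \<open>Z\<close> hold on the range of \<open>S\<close>, extend to its closure by
    continuity and to the whole space by \<open>Z = P Z P\<close>\<close>
  have sym: "selfadjoint Z"
    if "selfadjoint X" and Z: "\<And>x y. inner (X *\<^sub>V x) y = inner (Z *\<^sub>V S *\<^sub>V x) (S *\<^sub>V y)"
      and ZP: "\<And>x y. inner (Z *\<^sub>V x) y = inner (Z *\<^sub>V P *\<^sub>V x) (P *\<^sub>V y)" for X Z :: "'a bop"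
  proof (rule selfadjointI)
    fix x y
    have "inner (Z *\<^sub>V P *\<^sub>V x) (P *\<^sub>V y) = inner (P *\<^sub>V x) (Z *\<^sub>V P *\<^sub>V y)"
    proof (rule closure_range_closed_relation[where Q = "\<lambda>v w. inner (Z *\<^sub>V v) w = inner v (Z *\<^sub>V w)", OF _ _ PC PC])
      show "inner (Z *\<^sub>V S *\<^sub>V u) (S *\<^sub>V v) = inner (S *\<^sub>V u) (Z *\<^sub>V S *\<^sub>V v)" for u v
        using Z[of u v] Z[of v u] selfadjoint_inner[OF that(1), of u v] by (simp add: inner_commute)
    qed (intro closed_Collect_eq continuous_intros)
    also have "\<dots> = inner x (Z *\<^sub>V y)" using ZP[of y x] by (simp add: inner_commute)
    finally show "inner (Z *\<^sub>V x) y = inner x (Z *\<^sub>V y)" using ZP[of x y] by simp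
  qed
  have "\<bar>inner (A *\<^sub>V x) y\<bar> \<le> norm (S *\<^sub>V x) * norm (S *\<^sub>V y)" for x y
  proof -
    have "\<bar>inner (A *\<^sub>V x) y\<bar> \<le> sqrt (inner (A *\<^sub>V x) x) * sqrt (inner (A *\<^sub>V y) y)"
      using real_sqrt_le_mono[OF positive_op_cauchy_schwarz[OF A, of x y]] by (simp add: real_sqrt_mult)
    also have "\<dots> \<le> norm (S *\<^sub>V x) * norm (S *\<^sub>V y)"
      by (intro mult_mono A_le) (simp_all add: positive_op_nonneg[OF A])
    finally show ?thesis .
  qed
  from compression[OF this PC P]
  obtain D where D: "\<And>x y. inner (A *\<^sub>V x) y = inner (D *\<^sub>V S *\<^sub>V x) (S *\<^sub>V y)"
    and DP: "\<And>x y. inner (D *\<^sub>V x) y = inner (D *\<^sub>V P *\<^sub>V x) (P *\<^sub>V y)" by metis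
  have D_sa: "selfadjoint D" by (rule sym[OF positive_op_selfadjoint[OF A] D DP])
  have D_pos: "positive_op D"
  proof (rule positive_opI[OF D_sa])
    fix x
    have "0 \<le> inner (D *\<^sub>V P *\<^sub>V x) (P *\<^sub>V x)"
    proof (rule closure_range_closed_relation[where Q = "\<lambda>v _. 0 \<le> inner (D *\<^sub>V v) v", OF _ _ PC PC])
      show "0 \<le> inner (D *\<^sub>V S *\<^sub>V u) (S *\<^sub>V u)" for u using positive_op_nonneg[OF A, of u] by (simp add: D)
    qed (intro closed_Collect_le continuous_intros)
    then show "0 \<le> inner (D *\<^sub>V x) x" by (simp flip: DP)
  qed
  have B_form: "inner ((1 - D) *\<^sub>V S *\<^sub>V x) (S *\<^sub>V y) = inner (B *\<^sub>V x) y" for x y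
    by (simp add: inner_diff_left SS flip: D)
  have P_le: "inner (P *\<^sub>V x) (P *\<^sub>V x) \<le> inner x x" for x
  proof -
    have "norm (P *\<^sub>V x) * norm (P *\<^sub>V x) \<le> norm (P *\<^sub>V x) * norm x"
      using P[OF PC[of x], of x] norm_cauchy_schwarz[of "P *\<^sub>V x" x]
      by (simp flip: power2_norm_eq_inner power2_eq_square)
    then have "norm (P *\<^sub>V x) \<le> norm x" by (cases "P *\<^sub>V x = 0") auto
    then show ?thesis by (simp add: norm_le)
  qed
  have block_form: "0 \<le> inner (D *\<^sub>V x) x + 2 * inner (Z *\<^sub>V y) x + inner ((1 - D) *\<^sub>V y) y"
    if X: "positive_op (block A X X B)"
      and Z: "\<And>x y. inner (X *\<^sub>V x) y = inner (Z *\<^sub>V S *\<^sub>V x) (S *\<^sub>V y)"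
      and ZP: "\<And>x y. inner (Z *\<^sub>V x) y = inner (Z *\<^sub>V P *\<^sub>V x) (P *\<^sub>V y)" for X Z :: "'a bop" and x y
  proof -
    have "0 \<le> inner (D *\<^sub>V P *\<^sub>V x) (P *\<^sub>V x) + 2 * inner (Z *\<^sub>V P *\<^sub>V y) (P *\<^sub>V x)
        + inner ((1 - D) *\<^sub>V P *\<^sub>V y) (P *\<^sub>V y)"
    proof (rule closure_range_closed_relation[where Q = "\<lambda>v w. 0 \<le> inner (D *\<^sub>V v) v
          + 2 * inner (Z *\<^sub>V w) v + inner ((1 - D) *\<^sub>V w) w", OF _ _ PC PC])
      show "0 \<le> inner (D *\<^sub>V S *\<^sub>V u) (S *\<^sub>V u) + 2 * inner (Z *\<^sub>V S *\<^sub>V v) (S *\<^sub>V u)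
          + inner ((1 - D) *\<^sub>V S *\<^sub>V v) (S *\<^sub>V v)" for u v
        unfolding B_form D[symmetric] Z[symmetric] using X by (simp add: positive_block_iff)
    qed (intro closed_Collect_le continuous_intros)
    \<comment> \<open>\<open>1 - D\<close> is the identity on the orthogonal complement of the closed range\<close>
    also have "\<dots> \<le> inner (D *\<^sub>V x) x + 2 * inner (Z *\<^sub>V y) x + inner ((1 - D) *\<^sub>V y) y"
      using P_le[of y] by (simp add: inner_diff_left flip: DP ZP)
    finally show ?thesis .
  qed
  \<comment> \<open>the zero operator is a competitor, which gives \<open>D \<le> 1\<close>\<close>
  have zero: "positive_op (block A 0 0 B)"
    unfolding positive_block_iff
    using A B positive_op_nonneg[OF A] positive_op_nonneg[OF B]
    by (auto simp: positive_op_selfadjoint selfadjoint_adj selfadjoint_zero)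
  have E_pos: "positive_op (1 - D)"
  proof (rule positive_opI)
    show "0 \<le> inner ((1 - D) *\<^sub>V y) y" for y
      using block_form[OF zero, of 0 0 y] by simp
  qed (intro selfadjoint_diff selfadjoint_one D_sa)
  define a where "a = sqrt_op D"
  define b where "b = sqrt_op (1 - D)"
  have a: "positive_op a" "a * a = D" unfolding a_def by (fact positive_sqrt_op[OF D_pos] sqrt_op_square[OF D_pos])+
  have b: "positive_op b" "b * b = 1 - D" unfolding b_def by (fact positive_sqrt_op[OF E_pos] sqrt_op_square[OF E_pos])+
  have "D * b = b * D" unfolding b_def by (rule sqrt_op_commutes[OF E_pos]) (simp add: algebra_simps)
  then have ba: "b * a = a * b" unfolding a_def by (intro sqrt_op_commutes[OF D_pos]) simp
  have norm_a: "(norm (a *\<^sub>V x))\<^sup>2 = inner (D *\<^sub>V x) x" for x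
    unfolding power2_norm_eq_inner a(2)[symmetric] by (simp add: positive_op_inner[OF a(1)])
  have norm_b: "(norm (b *\<^sub>V x))\<^sup>2 = inner ((1 - D) *\<^sub>V x) x" for x
    unfolding power2_norm_eq_inner b(2)[symmetric] by (simp add: positive_op_inner[OF b(1)])
  define M where "M = S * (a * b) * S"
  have M: "inner (M *\<^sub>V x) y = inner (a *\<^sub>V b *\<^sub>V S *\<^sub>V x) (S *\<^sub>V y)" for x y
    by (simp add: M_def positive_op_inner[OF S])
  have M_sa: "selfadjoint M"
    unfolding M_def using selfadjoint_conj[OF selfadjoint_times[OF positive_op_selfadjoint[OF a(1)]
          positive_op_selfadjoint[OF b(1)] ba[symmetric]], of S]
    by (simp only: selfadjoint_adj[OF positive_op_selfadjoint[OF S]])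
  have "positive_op (block A M M B)"
    unfolding positive_block_iff
  proof (intro conjI allI)
    show "selfadjoint A" "selfadjoint B" by (rule positive_op_selfadjoint[OF A] positive_op_selfadjoint[OF B])+
    show "adj M = M" by (rule selfadjoint_adj[OF M_sa])
    fix x y
    have "inner (A *\<^sub>V x) x = (norm (a *\<^sub>V S *\<^sub>V x))\<^sup>2" unfolding norm_a by (rule D)
    moreover have "inner (B *\<^sub>V y) y = (norm (b *\<^sub>V S *\<^sub>V y))\<^sup>2" unfolding norm_b by (rule B_form[symmetric])
    moreover have "inner (M *\<^sub>V y) x = inner (a *\<^sub>V S *\<^sub>V x) (b *\<^sub>V S *\<^sub>V y)"
      using M[of y x] positive_op_inner[OF a(1), of "b *\<^sub>V S *\<^sub>V y" "S *\<^sub>V x"]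
      by (simp add: inner_commute)
    ultimately have "inner (A *\<^sub>V x) x + 2 * inner (M *\<^sub>V y) x + inner (B *\<^sub>V y) y
        = (norm (a *\<^sub>V S *\<^sub>V x + b *\<^sub>V S *\<^sub>V y))\<^sup>2"
      by (simp add: power2_norm_eq_inner inner_left_distrib inner_right_distrib inner_commute)
    then show "0 \<le> inner (A *\<^sub>V x) x + 2 * inner (M *\<^sub>V y) x + inner (B *\<^sub>V y) y" by simp
  qed
  moreover have "inner (X *\<^sub>V x) x \<le> inner (M *\<^sub>V x) x"
    if X: "selfadjoint X" "positive_op (block A X X B)" for X x
  proof -
    have "\<bar>inner (X *\<^sub>V x) y\<bar> \<le> norm (S *\<^sub>V x) * norm (S *\<^sub>V y)" for x y
    proof -
      have "sqrt (inner (A *\<^sub>V y) y) * sqrt (inner (B *\<^sub>V x) x) \<le> norm (S *\<^sub>V y) * norm (S *\<^sub>V x)"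
        by (intro mult_mono A_le B_le) (simp_all add: positive_op_nonneg[OF B])
      then show ?thesis using positive_block_cauchy_schwarz[OF X(2), of x y] by (simp add: mult.commute)
    qed
    from compression[OF this PC P]
    obtain Z where Z: "\<And>x y. inner (X *\<^sub>V x) y = inner (Z *\<^sub>V S *\<^sub>V x) (S *\<^sub>V y)"
      and ZP: "\<And>x y. inner (Z *\<^sub>V x) y = inner (Z *\<^sub>V P *\<^sub>V x) (P *\<^sub>V y)" by metis
    have "inner (Z *\<^sub>V S *\<^sub>V x) (S *\<^sub>V x) \<le> inner (a *\<^sub>V b *\<^sub>V S *\<^sub>V x) (S *\<^sub>V x)"
    proof (rule commuting_block_le[OF a(1) b(1) ba[symmetric] sym[OF X(1) Z ZP]])
      show "0 \<le> (norm (a *\<^sub>V x))\<^sup>2 + 2 * inner (Z *\<^sub>V y) x + (norm (b *\<^sub>V y))\<^sup>2" for x y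
        unfolding norm_a norm_b by (rule block_form[OF X(2) Z ZP])
    qed
    then show ?thesis by (simp add: Z M)
  qed
  ultimately show thesis using that M_sa by blast
qed

lemma loewner_leI:
  assumes "selfadjoint A" "selfadjoint B" "\<And>x. inner (A *\<^sub>V x) x \<le> inner (B *\<^sub>V x) x"
  shows "A \<le>\<^sub>L B"
  using assms by (simp add: loewner_le_def positive_op_iff selfadjoint_diff inner_diff_left)

lemma loewner_le_antisym:
  assumes "A \<le>\<^sub>L B" "B \<le>\<^sub>L A" shows "A = B"
proof (rule bop_eqI)
  fix x
  have pos: "positive_op (B - A)" "positive_op (A - B)" using assms by (auto simp: loewner_le_def)
  have "inner ((B - A) *\<^sub>V x) x = 0"
    using positive_op_nonneg[OF pos(1), of x] positive_op_nonneg[OF pos(2), of x]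
    by (simp add: inner_diff_left)
  from positive_op_form_zero[OF pos(1) this] show "A *\<^sub>V x = B *\<^sub>V x" by simp
qed

text \<open>Positivity of the matrix already makes \<open>A\<close> and \<open>B\<close> positive and \<open>X\<close> self-adjoint, so the maximum
  that defines the geometric mean exists and \<open>X\<close> is one of the operators over which it is taken.\<close>

lemma geometric_mean_upper:
  assumes block: "positive_op (block A X X B)"
  shows "X \<le>\<^sub>L A \<sharp> B"
proof -
  have form: "0 \<le> inner (A *\<^sub>V x) x + 2 * inner (X *\<^sub>V y) x + inner (B *\<^sub>V y) y" for x y
    using block by (simp add: positive_block_iff)
  have sa: "selfadjoint A" "selfadjoint B" "selfadjoint X"
    using block by (simp_all add: positive_block_iff selfadjoint_def)
  have A: "positive_op A" by (rule positive_opI[OF sa(1)]) (use form[of _ 0] in simp)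
  have B: "positive_op B" by (rule positive_opI[OF sa(2)]) (use form[of 0] in simp)
  define Xs where "Xs = {X. selfadjoint X \<and> positive_op (block A X X B)}"
  obtain M where M: "selfadjoint M" "positive_op (block A M M B)"
    and max: "\<And>X x. selfadjoint X \<Longrightarrow> positive_op (block A X X B) \<Longrightarrow> inner (X *\<^sub>V x) x \<le> inner (M *\<^sub>V x) x"
    using geometric_mean_exists[OF A B] by metis
  have M_max: "M \<in> Xs" "\<And>X. X \<in> Xs \<Longrightarrow> X \<le>\<^sub>L M"
    using M max by (auto simp: Xs_def intro: loewner_leI)
  have "A \<sharp> B = (THE M. M \<in> Xs \<and> (\<forall>X\<in>Xs. X \<le>\<^sub>L M))"
    by (simp add: geometric_mean_def Xs_def Let_def)
  also have "\<dots> = M"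
  proof (rule the_equality)
    show "M \<in> Xs \<and> (\<forall>X\<in>Xs. X \<le>\<^sub>L M)" using M_max by blast
    show "M' = M" if "M' \<in> Xs \<and> (\<forall>X\<in>Xs. X \<le>\<^sub>L M')" for M'
      using that M_max by (intro loewner_le_antisym) blast+
  qed
  finally show ?thesis using M_max(2)[of X] block sa(3) by (simp add: Xs_def)
qed

section \<open>The inequalities\<close>

theorem theorem2p1:
  fixes A B X Y :: "'h::chilbert_space bop"
    and \<Phi> :: "'h bop \<Rightarrow> 'k::chilbert_space bop"
  shows
    "(weakly_two_positive \<Phi> \<longrightarrow>
        (\<forall>V. polar_decomposition (adj X * adj A * Y) V \<longrightarrow>
          \<Phi> (abs_op (adj X * adj A * Y))
            \<le>\<^sub>L \<Phi> (adj V * adj X * abs_op A * X * V) \<sharp> \<Phi> (adj Y * abs_op (adj A) * Y)))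
     \<and> (two_positive \<Phi> \<and> star_map \<Phi> \<longrightarrow>
        (\<forall>U. polar_decomposition (\<Phi> (adj X * adj A * Y)) U \<longrightarrow>
          abs_op (\<Phi> (adj X * adj A * Y))
            \<le>\<^sub>L (adj U * \<Phi> (adj X * abs_op A * X) * U) \<sharp> \<Phi> (adj Y * abs_op (adj A) * Y)))"
proof (intro conjI impI allI)
  fix V
  assume \<Phi>: "weakly_two_positive \<Phi>" and V: "polar_decomposition (adj X * adj A * Y) V"
  let ?W = "adj X * adj A * Y"
  have W: "adj V * ?W = abs_op ?W" by (rule polar_decomposition_adj_times[OF V])
  have W': "adj ?W * V = abs_op ?W" using arg_cong[OF W, of adj] by simp
  have "positive_op (block (adj (X * V) * abs_op A * (X * V)) (adj (X * V) * adj A * Y)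
      (adj Y * A * (X * V)) (adj Y * abs_op (adj A) * Y))"
    by (rule positive_block_conj[OF positive_block_abs_op])
  then have "positive_op (block (adj V * adj X * abs_op A * X * V) (abs_op ?W) (abs_op ?W)
      (adj Y * abs_op (adj A) * Y))"
    using W W' by (simp add: mult.assoc)
  then show "\<Phi> (abs_op ?W) \<le>\<^sub>L \<Phi> (adj V * adj X * abs_op A * X * V) \<sharp> \<Phi> (adj Y * abs_op (adj A) * Y)"
    using \<Phi> by (intro geometric_mean_upper) (simp add: weakly_two_positive_def)
next
  fix U
  let ?W = "adj X * adj A * Y" and ?P = "\<Phi> (adj X * abs_op A * X)" and ?R = "\<Phi> (adj Y * abs_op (adj A) * Y)"
  assume \<Phi>: "two_positive \<Phi> \<and> star_map \<Phi>" and U: "polar_decomposition (\<Phi> ?W) U"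
  have W: "adj U * \<Phi> ?W = abs_op (\<Phi> ?W)" by (rule polar_decomposition_adj_times[OF U])
  have W': "adj (\<Phi> ?W) * U = abs_op (\<Phi> ?W)" using arg_cong[OF W, of adj] by simp
  have "positive_op (block (adj X * abs_op A * X) ?W (adj Y * A * X) (adj Y * abs_op (adj A) * Y))"
    by (rule positive_block_conj[OF positive_block_abs_op])
  then have "positive_op (block ?P (\<Phi> ?W) (\<Phi> (adj Y * A * X)) ?R)"
    using \<Phi> by (simp add: two_positive_def)
  moreover have "\<Phi> (adj Y * A * X) = adj (\<Phi> ?W)"
  proof -
    have "adj ?W = adj Y * A * X" by (simp add: mult.assoc)
    then show ?thesis using \<Phi> unfolding star_map_def by metis
  qed
  ultimately have "positive_op (block ?P (\<Phi> ?W) (adj (\<Phi> ?W)) ?R)" by simp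
  from positive_block_conj[OF this, of U 1]
  have "positive_op (block (adj U * ?P * U) (abs_op (\<Phi> ?W)) (abs_op (\<Phi> ?W)) ?R)"
    by (simp add: W W' selfadjoint_adj[OF selfadjoint_one])
  then show "abs_op (\<Phi> ?W) \<le>\<^sub>L (adj U * ?P * U) \<sharp> ?R" by (rule geometric_mean_upper)
qed

end
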